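(* Consider the system, the algorithms PBP and BP with parameter $V$, the dual function $g$, and the constants $G,K$ described in the context. Suppose: (i) the optimal solution $\boldsymbol\gamma^*$ of $\max\{g(\boldsymbol\gamma):\boldsymbol\gamma\succeq\boldsymbol 0\}$ is unique; the slack condition holds with some $\eta>0$, i.e. there exist power vectors $\boldsymbol P_m^{(s_i)}\in\mathcal P^{(s_i)}$ and probabilities $a_m^{(s_i)}$ with $\lambda_n-\sum_{s_i}\pi_{s_i}\sum_m a_m^{(s_i)}\mu_n(s_i,\boldsymbol P_m^{(s_i)})\le-\eta$ for all $n$; and there is a constant $L>0$ independent of $V$ such that $g(\boldsymbol\gamma^* )\ge g(\boldsymbol\gamma)+L\|\boldsymbol\gamma^*-\boldsymbol\gamma\|$ for all $\boldsymbol\gamma\succeq\boldsymbol 0$; (ii) $\boldsymbol\gamma^*=\Theta(V)>0$; (iii) there exists a steady-state distribution of the queue vector $\boldsymbol Q(t)$ under PBP; (iv) $D_n=O\!\left(\frac{1}{A_{\max}}\big[\gamma_n^*-G-K(\log V)^2-\mu_{\max}\big]^+\right)$ for all $n$; (v) the FIFO queueing discipline is used. Then, under PBP with a sufficiently large $V$, $$Q_{\mathrm{av}}^{(-1)}\le Q_{\mathrm{av}}^{\mathrm{BP}}-\sum_n D_n\Big[\lambda_n-O\Big(\frac{1}{V^{\log V}}\Big)\Big]^+,$$ where $Q_{\mathrm{av}}^{(-1)}$ is the average size of the actual backlog $\sum_n Q_n^{(-1)}(t)$ under PBP and $Q_{\mathrm{av}}^{\mathrm{BP}}$ is the average total queue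 size under Backpressure without prediction with the same $V$.
   Context: Time is slotted, $t\in\{0,1,2,\dots\}$, and $[x]^+=\max(x,0)$. A server serves $N$ users. Arrivals: $A_n(t)$ is the number of user-$n$ packets arriving in slot $t$; $\boldsymbol A(t)=(A_1(t),\dots,A_N(t))$ is i.i.d. over $t$ with $\mathbb E\{A_n(t)\}=\lambda_n$ and $0\le A_n(t)\le A_{\max}$. Channels and service: the channel state vector $\boldsymbol S(t)$ is i.i.d. over $t$ with values in a finite set $\{s_1,\dots,s_K\}$ (here the number of states is unrelated to the constant $K$ below), $\Pr\{\boldsymbol S(t)=s_i\}=\pi_{s_i}$. In each slot, when $\boldsymbol S(t)=s_i$, the server chooses a power vector $\boldsymbol P(t)$ in a compact set $\mathcal P^{(s_i)}$ (in which $0\le P_n\le P_{\max}$). The service rate of user $n$ is $\mu_n(t)=\mu_n(\boldsymbol S(t),\boldsymbol P(t))\ge 0$, continuous in $\boldsymbol P$ for each state and bounded by $\mu_{\max}$. The cost in slot $t$ is $f(\boldsymbol S(t),\boldsymbol P(t))$, continuous in $\boldsymbol P$ for each state and bounded above by $f^{\max}$. Prediction: $\boldsymbol D=(D_1,\dots,D_N)$ with integers $D_n\ge 0$. At time $t$ the server knows $A_n(t),\dots,A_n(t+D_n-1)$ and may serve these arrivals in slot $t$. It allocates rates $\mu_n^{(d)}(t)\ge 0$, $-1\le d\le D_n-1$, with $\sum_{d=-1}^{D_n-1}\mu_n^{(d)}(t)\le \mu_n(t)$; $\mu_n^{(d)}(t)$ for $d\ge 0$ serves the arrivals of slot $t+d$,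 and $\mu_n^{(-1)}(t)$ serves packets already in the system. With $Q_n^{(d)}(t)$ ($0\le d\le D_n-1$) the number of remaining unserved arrivals of slot $t+d$ and $Q_n^{(-1)}(t)$ the actual backlog, $Q_n^{(-1)}(0)=0$, $Q_n^{(d)}(0)=A_n(d)$ for $0\le d\le D_n-1$, and - $Q_n^{(D_n-1)}(t+1)=A_n(t+D_n)$; - $Q_n^{(d)}(t+1)=[Q_n^{(d+1)}(t)-\mu_n^{(d+1)}(t)]^+$ for $0\le d\le D_n-2$; - $Q_n^{(-1)}(t+1)=[Q_n^{(-1)}(t)-\mu_n^{(-1)}(t)]^+ +[Q_n^{(0)}(t)-\mu_n^{(0)}(t)]^+$. If $D_n=0$, there is only $Q_n^{(-1)}$, with $Q_n^{(-1)}(t+1)=[Q_n^{(-1)}(t)-\mu_n^{(-1)}(t)]^+ +A_n(t)$. Put $Q_n^{\mathrm{sum}}(t)=\sum_{d=-1}^{D_n-1}Q_n^{(d)}(t)$. Average queue sizes are $\limsup_{t\to\infty}\frac1t\sum_{\tau=0}^{t-1}\mathbb E\{\cdot\}$. Fully-efficient allocation: for every $n,t$, (i) $\sum_{d}\mu_n^{(d)}(t)=\mu_n(t)$, and (ii) whenever $\mu_n^{(d)}(t)>Q_n^{(d)}(t)$ for some $d$, then $\mu_n^{(d')}(t)\ge Q_n^{(d')}(t)$ for all $d'\ne d$. PBP: in every slot, observe $\boldsymbol S(t)$ and $Q_n^{\mathrm{sum}}(t)$, choose $\boldsymbol P(t)\in\mathcal P^{(\boldsymbol S(t))}$ minimizing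 $Vf(\boldsymbol S(t),\boldsymbol P)-\sum_n Q_n^{\mathrm{sum}}(t)\mu_n(\boldsymbol S(t),\boldsymbol P)$, allocate the rates $\mu_n^{(d)}(t)$ in a fully-efficient manner according to the queueing discipline, and update the queues by $Q_n^{(D_n-1)}(t+1)=A_n(t+D_n)$, $Q_n^{(d)}(t+1)=[Q_n^{(d+1)}(t)-\mu_n^{(d+1)}(t)]^+$ for $0\le d\le D_n-2$, and $Q_n^{(-1)}(t+1)=[Q_n^{(-1)}(t)-\mu_n^{(-1)}(t)]^+ +[Q_n^{(0)}(t)-\mu_n^{(0)}(t)]^+$ if $D_n\ge 1$, and by $Q_n^{(-1)}(t+1)=[Q_n^{(-1)}(t)-\mu_n^{(-1)}(t)]^+ +A_n(t)$ if $D_n=0$. Under FIFO, packets of user $n$ are served in the order: first those in $Q_n^{(-1)}(t)$ (oldest first), then those in $Q_n^{(0)}(t)$, then $Q_n^{(1)}(t)$, and so on. BP (no prediction, $D_n=0$ for all $n$): queues $Q_n(t)$ with $Q_n(0)=0$; in every slot choose $\boldsymbol P(t)\in\mathcal P^{(\boldsymbol S(t))}$ minimizing $Vf(\boldsymbol S(t),\boldsymbol P)-\sum_n Q_n(t)\mu_n(\boldsymbol S(t),\boldsymbol P)$ and set $Q_n(t+1)=[Q_n(t)-\mu_n(t)]^+ +A_n(t)$. In both algorithms a minimizer is selected by the same fixed rule. Dual function: for $\boldsymbol\gamma\in\mathbb R^N$, $\boldsymbol\gamma\succeq\boldsymbol 0$, $$g(\boldsymbol\gamma)=\sum_{s_i}\pi_{s_i}\inf_{\boldsymbol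 P\in\mathcal P^{(s_i)}}\Big\{Vf(s_i,\boldsymbol P)+\sum_n\gamma_n\big[\lambda_n-\mu_n(s_i,\boldsymbol P)\big]\Big\}.$$ $g$ and $\boldsymbol\gamma^*$ depend on $V$; $\boldsymbol\gamma^*=\Theta(V)>0$ means every component $\gamma_n^*$ is positive and of order $V$. Constants $G,K$: it is a known result that under hypothesis (i) there exist constants $G,K,c=\Theta(1)$ (all independent of $V$) such that, under BP without prediction, for every $m\in\mathbb R_+$, $$\limsup_{t\to\infty}\frac1t\sum_{\tau=0}^{t-1}\Pr\{\exists\,n:\ |Q_n(\tau)-\gamma_n^*|>G+Km\}\le c\,e^{-m};$$ $G,K$ in hypothesis (iv) are these constants. The $O(\cdot)$ notation is with respect to $V$ growing.
   Formalization: Condition (iv) is read with constant 1; A(t) and S(t) are taken independent; users with different D_n have independent arrivals; and the steady state in (iii) is the long-run law of the vector Q^sum, the same from the prescribed and from empty initial queues. *)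

theory Defs
  imports "HOL-Probability.Probability" "HOL-Library.Landau_Symbols"
begin

section \<open>The slotted system\<close>

text \<open>
  Users are the elements of the finite type \<open>'n\<close>, channel states those of the finite type \<open>'s\<close>;
  vectors over users are \<open>real ^ 'n\<close>, ordered componentwise.  The pairs \<open>(A t, S t)\<close> are
  independent over slots and \<open>A t\<close>, \<open>S t\<close> are independent of each other, so that the arrival
  and channel processes are two independent i.i.d. processes.
\<close>

locale slotted_system = prob_space M
  for M :: "'w measure" +
  fixes A :: "nat \<Rightarrow> 'w \<Rightarrow> real ^ 'n" and S :: "nat \<Rightarrow> 'w \<Rightarrow> 's::finite"
    and lam :: "real ^ 'n" and p_ch :: "'s \<Rightarrow> real"
    and PP :: "'s \<Rightarrow> (real ^ 'n) set"
    and mu :: "'n \<Rightarrow> 's \<Rightarrow> real ^ 'n \<Rightarrow> real" and f :: "'s \<Rightarrow> real ^ 'n \<Rightarrow> real"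
    and A_max P_max mu_max f_max :: real
  assumes indep_slots:
      "indep_vars (\<lambda>_. borel \<Otimes>\<^sub>M count_space UNIV) (\<lambda>t \<omega>. (A t \<omega>, S t \<omega>)) UNIV"
    and indep_arrival_channel:
      "\<And>t s B. B \<in> sets borel \<Longrightarrow>
         prob {\<omega> \<in> space M. A t \<omega> \<in> B \<and> S t \<omega> = s} =
         prob {\<omega> \<in> space M. A t \<omega> \<in> B} * prob {\<omega> \<in> space M. S t \<omega> = s}"
    and arrivals_identical: "\<And>t. distr M borel (A t) = distr M borel (A 0)"
    and arrivals_mean: "\<And>t n. expectation (\<lambda>\<omega>. A t \<omega> $ n) = lam $ n"
    and arrivals_bounded: "\<And>t n \<omega>. \<omega> \<in> space M \<Longrightarrow> 0 \<le> A t \<omega> $ n \<and> A t \<omega> $ n \<le> A_max"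
    and A_max_pos: "0 < A_max"
    and channel_prob: "\<And>t s. prob {\<omega> \<in> space M. S t \<omega> = s} = p_ch s"
    and power_compact: "\<And>s. compact (PP s)"
    and power_bounded: "\<And>s P n. P \<in> PP s \<Longrightarrow> 0 \<le> P $ n \<and> P $ n \<le> P_max"
    and rate_continuous: "\<And>n s. continuous_on (PP s) (mu n s)"
    and rate_bounded: "\<And>n s P. P \<in> PP s \<Longrightarrow> 0 \<le> mu n s P \<and> mu n s P \<le> mu_max"
    and cost_continuous: "\<And>s. continuous_on (PP s) (f s)"
    and cost_bounded: "\<And>s P. P \<in> PP s \<Longrightarrow> f s P \<le> f_max"

text \<open>Users with different prediction windows have independent arrivals; within a group of users
  sharing a window the arrivals may be arbitrarily dependent.  Exactly then is
  \<open>(A\<^sub>n(t + D\<^sub>n))\<^sub>n\<close>, the vector admitted in slot \<open>t\<close> by the predictive system,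
  distributed like \<open>A(t)\<close>.\<close>

definition independent_across_windows ::
  "'w measure \<Rightarrow> (nat \<Rightarrow> 'w \<Rightarrow> real ^ 'n) \<Rightarrow> ('n \<Rightarrow> nat) \<Rightarrow> bool" where
  "independent_across_windows M A D \<longleftrightarrow>
     (\<forall>t. prob_space.indep_vars M (\<lambda>_. borel)
            (\<lambda>d \<omega>. \<chi> n. if D n = d then A t \<omega> $ n else 0) (UNIV :: nat set))"


section \<open>Slack condition and dual function\<close>

definition slack_condition ::
  "real ^ 'n \<Rightarrow> ('s::finite \<Rightarrow> real) \<Rightarrow> ('s \<Rightarrow> (real ^ 'n) set) \<Rightarrow>
   ('n \<Rightarrow> 's \<Rightarrow> real ^ 'n \<Rightarrow> real) \<Rightarrow> real \<Rightarrow> bool" where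
  "slack_condition lam p_ch PP mu \<eta> \<longleftrightarrow>
     (\<exists>(R::nat) p a.
        (\<forall>s. \<forall>m<R. p s m \<in> PP s \<and> 0 \<le> a s m) \<and> (\<forall>s. (\<Sum>m<R. a s m) = 1) \<and>
        (\<forall>n. lam $ n - (\<Sum>s\<in>UNIV. p_ch s * (\<Sum>m<R. a s m * mu n s (p s m))) \<le> - \<eta>))"

definition dual_function ::
  "real ^ 'n \<Rightarrow> ('s::finite \<Rightarrow> real) \<Rightarrow> ('s \<Rightarrow> (real ^ 'n) set) \<Rightarrow>
   ('n \<Rightarrow> 's \<Rightarrow> real ^ 'n \<Rightarrow> real) \<Rightarrow> ('s \<Rightarrow> real ^ 'n \<Rightarrow> real) \<Rightarrow>
   real \<Rightarrow> real ^ 'n \<Rightarrow> real" where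
  "dual_function lam p_ch PP mu f V \<gamma> =
     (\<Sum>s\<in>UNIV. p_ch s * (INF P\<in>PP s. V * f s P + (\<Sum>n\<in>UNIV. \<gamma> $ n * (lam $ n - mu n s P))))"


section \<open>Power choice and Backpressure\<close>

text \<open>A rule picks the power vector from the channel state and the queue vector.  Measurability
  in the queue vector makes the queue processes random variables.\<close>

definition backpressure_rule ::
  "('s \<Rightarrow> (real ^ 'n) set) \<Rightarrow> ('n \<Rightarrow> 's \<Rightarrow> real ^ 'n \<Rightarrow> real) \<Rightarrow> ('s \<Rightarrow> real ^ 'n \<Rightarrow> real) \<Rightarrow>
   real \<Rightarrow> ('s \<Rightarrow> real ^ 'n \<Rightarrow> real ^ 'n) \<Rightarrow> bool" where
  "backpressure_rule PP mu f V rule \<longleftrightarrow>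
     (\<forall>s. rule s \<in> borel_measurable borel \<and>
          (\<forall>q\<ge>0. is_arg_min (\<lambda>P. V * f s P - (\<Sum>n\<in>UNIV. q $ n * mu n s P))
                              (\<lambda>P. P \<in> PP s) (rule s q)))"

primrec bp_queue ::
  "(nat \<Rightarrow> 'w \<Rightarrow> real ^ 'n) \<Rightarrow> (nat \<Rightarrow> 'w \<Rightarrow> 's) \<Rightarrow> ('n \<Rightarrow> 's \<Rightarrow> real ^ 'n \<Rightarrow> real) \<Rightarrow>
   ('s \<Rightarrow> real ^ 'n \<Rightarrow> real ^ 'n) \<Rightarrow> nat \<Rightarrow> 'w \<Rightarrow> real ^ 'n" where
  "bp_queue A S mu rule 0 \<omega> = 0"
| "bp_queue A S mu rule (Suc t) \<omega> =
     (\<chi> n. max 0 (bp_queue A S mu rule t \<omega> $ n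
                    - mu n (S t \<omega>) (rule (S t \<omega>) (bp_queue A S mu rule t \<omega>)))
            + A t \<omega> $ n)"


section \<open>Predictive Backpressure\<close>

text \<open>Queue indices of a user with window \<open>D\<close>: index \<open>-1\<close> is the actual backlog, index
  \<open>d \<ge> 0\<close> the remaining predicted arrivals of the slot \<open>d\<close> slots ahead.  The values of a
  queue state outside the window are irrelevant.\<close>

definition window :: "nat \<Rightarrow> int set" where
  "window D = {-1..<int D}"

definition total_queue :: "('n \<Rightarrow> nat) \<Rightarrow> ('n \<Rightarrow> int \<Rightarrow> real) \<Rightarrow> real ^ 'n" where
  "total_queue D q = (\<chi> n. \<Sum>d\<in>window (D n). q n d)"

definition fully_efficient :: "nat \<Rightarrow> real \<Rightarrow> (int \<Rightarrow> real) \<Rightarrow> (int \<Rightarrow> real) \<Rightarrow> bool" where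
  "fully_efficient D r q m \<longleftrightarrow>
     (\<Sum>d\<in>window D. m d) = r \<and>
     (\<forall>d\<in>window D. m d > q d \<longrightarrow> (\<forall>d'\<in>window D - {d}. m d' \<ge> q d'))"

text \<open>Under FIFO a queue receives service only if all queues holding older packets are
  emptied in that slot.\<close>

definition fifo :: "nat \<Rightarrow> (int \<Rightarrow> real) \<Rightarrow> (int \<Rightarrow> real) \<Rightarrow> bool" where
  "fifo D q m \<longleftrightarrow>
     (\<forall>d\<in>window D. m d > 0 \<longrightarrow> (\<forall>d'\<in>window D. d' < d \<longrightarrow> m d' \<ge> q d'))"

text \<open>One slot of a user with window \<open>D\<close>; \<open>a\<close> is the arrival of the slot \<open>D\<close> slots ahead.\<close>

definition queue_update ::
  "nat \<Rightarrow> real \<Rightarrow> (int \<Rightarrow> real) \<Rightarrow> (int \<Rightarrow> real) \<Rightarrow> (int \<Rightarrow> real) \<Rightarrow> bool" where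
  "queue_update D a m q q' \<longleftrightarrow>
     (if D = 0 then q' (-1) = max 0 (q (-1) - m (-1)) + a
      else q' (int D - 1) = a \<and>
           (\<forall>d\<in>{0..int D - 2}. q' d = max 0 (q (d + 1) - m (d + 1))) \<and>
           q' (-1) = max 0 (q (-1) - m (-1)) + max 0 (q 0 - m 0))"

definition pbp_fifo_dynamics ::
  "'w measure \<Rightarrow> (nat \<Rightarrow> 'w \<Rightarrow> real ^ 'n) \<Rightarrow> (nat \<Rightarrow> 'w \<Rightarrow> 's) \<Rightarrow>
   ('n \<Rightarrow> 's \<Rightarrow> real ^ 'n \<Rightarrow> real) \<Rightarrow> ('s \<Rightarrow> real ^ 'n \<Rightarrow> real ^ 'n) \<Rightarrow> ('n \<Rightarrow> nat) \<Rightarrow>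
   (nat \<Rightarrow> 'w \<Rightarrow> 'n \<Rightarrow> int \<Rightarrow> real) \<Rightarrow> bool" where
  "pbp_fifo_dynamics M A S mu rule D Q \<longleftrightarrow>
     (\<forall>\<omega>\<in>space M. \<forall>t n. \<exists>m.
        (\<forall>d\<in>window (D n). 0 \<le> m d) \<and>
        fully_efficient (D n) (mu n (S t \<omega>) (rule (S t \<omega>) (total_queue D (Q t \<omega>)))) (Q t \<omega> n) m \<and>
        fifo (D n) (Q t \<omega> n) m \<and>
        queue_update (D n) (A (t + D n) \<omega> $ n) m (Q t \<omega> n) (Q (Suc t) \<omega> n))"

definition predicted_start ::
  "'w measure \<Rightarrow> (nat \<Rightarrow> 'w \<Rightarrow> real ^ 'n) \<Rightarrow> ('n \<Rightarrow> nat) \<Rightarrow>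
   (nat \<Rightarrow> 'w \<Rightarrow> 'n \<Rightarrow> int \<Rightarrow> real) \<Rightarrow> bool" where
  "predicted_start M A D Q \<longleftrightarrow>
     (\<forall>\<omega>\<in>space M. \<forall>n. Q 0 \<omega> n (-1) = 0 \<and> (\<forall>d<D n. Q 0 \<omega> n (int d) = A d \<omega> $ n))"

definition empty_start ::
  "'w measure \<Rightarrow> ('n \<Rightarrow> nat) \<Rightarrow> (nat \<Rightarrow> 'w \<Rightarrow> 'n \<Rightarrow> int \<Rightarrow> real) \<Rightarrow> bool" where
  "empty_start M D Q \<longleftrightarrow> (\<forall>\<omega>\<in>space M. \<forall>n. \<forall>d\<in>window (D n). Q 0 \<omega> n d = 0)"


section \<open>Long-run behaviour\<close>

definition time_avg :: "'w measure \<Rightarrow> (nat \<Rightarrow> 'w \<Rightarrow> real) \<Rightarrow> ereal" where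
  "time_avg M X = limsup (\<lambda>t. ereal (1 / real t * (\<Sum>\<tau><t. \<integral>\<omega>. X \<tau> \<omega> \<partial>M)))"

definition time_avg_prob :: "'w measure \<Rightarrow> (nat \<Rightarrow> 'w \<Rightarrow> bool) \<Rightarrow> ereal" where
  "time_avg_prob M E = limsup (\<lambda>t. ereal (1 / real t * (\<Sum>\<tau><t. measure M {\<omega>\<in>space M. E \<tau> \<omega>})))"

text \<open>Convergence in distribution to \<open>\<nu>\<close> in the sense of time averages.  It is implied by
  ordinary convergence in distribution and also allows periodic chains.\<close>

definition long_run_distribution ::
  "'w measure \<Rightarrow> (nat \<Rightarrow> 'w \<Rightarrow> real ^ 'n) \<Rightarrow> (real ^ 'n) measure \<Rightarrow> bool" where
  "long_run_distribution M X \<nu> \<longleftrightarrow>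
     prob_space \<nu> \<and> sets \<nu> = sets borel \<and>
     (\<forall>h :: real ^ 'n \<Rightarrow> real. continuous_on UNIV h \<longrightarrow> bounded (range h) \<longrightarrow>
        (\<lambda>t. 1 / real t * (\<Sum>\<tau><t. \<integral>\<omega>. h (X \<tau> \<omega>) \<partial>M)) \<longlonglongrightarrow> (\<integral>x. h x \<partial>\<nu>))"

text \<open>The steady state is a property of the algorithm and not of the start: the process of
  queue vectors \<open>(Q\<^sub>n\<^sup>s\<^sup>u\<^sup>m(t))\<^sub>n\<close> reaches it both from the prescribed initial
  state and from empty queues.  Without this, preserved lattice classes of the queue vector allow
  different time averages for the two starts.\<close>

definition pbp_steady_state ::
  "'w measure \<Rightarrow> (nat \<Rightarrow> 'w \<Rightarrow> real ^ 'n) \<Rightarrow> (nat \<Rightarrow> 'w \<Rightarrow> 's) \<Rightarrow>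
   ('n \<Rightarrow> 's \<Rightarrow> real ^ 'n \<Rightarrow> real) \<Rightarrow> ('s \<Rightarrow> real ^ 'n \<Rightarrow> real ^ 'n) \<Rightarrow> ('n \<Rightarrow> nat) \<Rightarrow>
   (real ^ 'n) measure \<Rightarrow> bool" where
  "pbp_steady_state M A S mu rule D \<nu> \<longleftrightarrow>
     (\<forall>Q. pbp_fifo_dynamics M A S mu rule D Q \<longrightarrow>
          predicted_start M A D Q \<or> empty_start M D Q \<longrightarrow>
          long_run_distribution M (\<lambda>t \<omega>. total_queue D (Q t \<omega>)) \<nu>)"

end

theory Submission
  imports Defs
begin

text \<open>
  Fully-efficient service makes the total queue \<open>Q\<^sup>s\<^sup>u\<^sup>m\<close> of the predictive system follow the
  Backpressure recursion, fed by the arrivals \<open>A\<^sub>n(t + D\<^sub>n)\<close>.  These have the law of \<open>A\<^sub>n(t)\<close>, so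
  started empty it is Backpressure in distribution, and by the steady-state hypothesis the
  prescribed start has the same limit distribution.  A Lyapunov drift for the fourth power of the
  norm bounds the averaged second moments, whence also the mean queue sizes agree in the limit.

  Under FIFO the packets left at time \<open>t\<close> are the most recent ones, so the actual backlog is
  \<open>max 0 (Q\<^sup>s\<^sup>u\<^sup>m(t) - \<Sum>d<D. A(t + d))\<close>.  It falls short of removing the \<open>D\<close> future slots completely
  only when \<open>Q\<^sup>s\<^sup>u\<^sup>m(t) < D * A_max\<close>, an event of frequency \<open>c / V powr ln V\<close> by the concentration
  hypothesis with \<open>m = (ln V)\<^sup>2\<close> and the bound on the window.
\<close>

section \<open>FIFO service of one user\<close>

text \<open>No filtration by whole slots separates the queue from its next input. Each slot is
  therefore split into independent components, one per window length and one for the channel, and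
  the past at time t is a set of (slot, component) pairs whose horizon depends on the component.
  Moving the components separately does not change the law of the input.

  The limit law can be tested only with bounded continuous functions. Passing to means needs uniform
  integrability in time average; a quadratic Lyapunov function would bound first moments only, hence
  the fourth power. What the prediction fails to remove is dominated by a function that is itself
  bounded and continuous. Its average is therefore shared by both systems, and it is estimated for
  Backpressure, where concentration is given: it is at most \<open>D n * A_max\<close>, and zero off
  the deviation event. This is the origin of the factor \<open>A_max\<close> in the error.\<close>

lemma finite_window [simp]: "finite (window D)"
  by (simp add: window_def)

lemma window_0 [simp]: "window 0 = {-1}"
  by (auto simp: window_def)

lemma minus_one_in_window [simp]: "-1 \<in> window D"
  by (simp add: window_def)

lemma window_Suc: "window (Suc D) = insert (int D) (window D)"
  by (auto simp: window_def)

lemma sum_window: "(\<Sum>d\<in>window D. g d) = g (-1) + (\<Sum>d<D. g (int d))"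
proof (induction D)
  case (Suc D)
  have "int D \<notin> window D" by (simp add: window_def)
  then show ?case using Suc by (simp add: window_Suc add_ac)
qed simp

text \<open>Either no queue is overserved and no rate is wasted, or one is overserved and full
  efficiency then empties all of them. In both cases the positive part commutes with the
  sum.\<close>

lemma sum_max_fully_efficient:
  assumes "fully_efficient D r q m"
  shows "(\<Sum>d\<in>window D. max 0 (q d - m d)) = max 0 ((\<Sum>d\<in>window D. q d) - r)"
proof -
  have r: "r = (\<Sum>d\<in>window D. m d)" using assms by (simp add: fully_efficient_def)
  show ?thesis
  proof (cases "\<forall>d\<in>window D. m d \<le> q d")
    case True
    then have "(\<Sum>d\<in>window D. max 0 (q d - m d)) = (\<Sum>d\<in>window D. q d - m d)"
      by (intro sum.cong) auto
    moreover have "0 \<le> (\<Sum>d\<in>window D. q d - m d)"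
      using True by (intro sum_nonneg) auto
    ultimately show ?thesis by (simp add: r sum_subtractf)
  next
    case False
    then have *: "\<forall>d\<in>window D. q d \<le> m d"
      using assms unfolding fully_efficient_def by (metis DiffI linorder_not_le order.strict_implies_order singletonD)
    then have "(\<Sum>d\<in>window D. max 0 (q d - m d)) = (\<Sum>d\<in>window D. 0)"
      by (intro sum.cong) auto
    moreover have "(\<Sum>d\<in>window D. q d) \<le> r"
      unfolding r using * by (intro sum_mono) auto
    ultimately show ?thesis by simp
  qed
qed

text \<open>The shift of a slot only relabels residuals: index \<open>d + 1\<close> moves to
  \<open>d\<close>, and \<open>-1\<close> collects its own residual and that of \<open>0\<close>. So
  every fully efficient split of the rate gives the total the recursion of a single queue.\<close>

lemma sum_queue_update:
  assumes "fully_efficient D r q m" "queue_update D a m q q'"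
  shows "(\<Sum>d\<in>window D. q' d) = max 0 ((\<Sum>d\<in>window D. q d) - r) + a"
proof -
  have "(\<Sum>d\<in>window D. q' d) = (\<Sum>d\<in>window D. max 0 (q d - m d)) + a"
  proof (cases D)
    case 0
    then show ?thesis using assms(2) by (simp add: queue_update_def)
  next
    case (Suc k)
    have 1: "q' (int d) = max 0 (q (int (Suc d)) - m (int (Suc d)))" if "d < k" for d
    proof -
      have "int d \<in> {0..int D - 2}" using that Suc by auto
      then show ?thesis
        using assms(2) Suc unfolding queue_update_def by (simp add: add.commute)
    qed
    have "(\<Sum>d\<in>window D. q' d) = q' (-1) + ((\<Sum>d<k. q' (int d)) + q' (int k))"
      by (simp add: Suc sum_window)
    also have "(\<Sum>d<k. q' (int d)) = (\<Sum>d<k. max 0 (q (int (Suc d)) - m (int (Suc d))))"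
      by (rule sum.cong) (auto simp: 1 simp del: of_nat_Suc)
    also have "q' (int k) = a"
      using assms(2) Suc by (simp add: queue_update_def)
    also have "q' (-1) = max 0 (q (-1) - m (-1)) + max 0 (q 0 - m 0)"
      using assms(2) Suc by (simp add: queue_update_def)
    finally show ?thesis
      unfolding Suc sum_window by (simp add: sum.lessThan_Suc_shift del: sum.lessThan_Suc)
  qed
  then show ?thesis using sum_max_fully_efficient[OF assms(1)] by simp
qed

lemma queue_update_nonneg:
  assumes "queue_update D a m q q'" "0 \<le> a" "d \<in> window D"
  shows "0 \<le> q' d"
proof (cases "d = -1 \<or> d = int D - 1")
  case True
  then show ?thesis using assms by (auto simp: queue_update_def split: if_splits)
next
  case False
  then have "d \<in> {0..int D - 2}" "D \<noteq> 0" using assms(3) by (auto simp: window_def)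
  then show ?thesis using assms(1) by (auto simp: queue_update_def)
qed

text \<open>The slots of the unserved packets are contiguous: as soon as an older packet waits,
  all later arrivals are untouched.\<close>

lemma fifo_untouched_step:
  assumes upd: "queue_update D (a (t + D)) m q q'"
    and ff: "fifo D q m" and m: "\<forall>d\<in>window D. 0 \<le> m d"
    and inv: "\<And>d e. \<lbrakk>d \<in> window D; int e \<in> window D; d < int e; 0 < q d\<rbrakk> \<Longrightarrow> q (int e) = a (t + e)"
    and a: "\<And>u. 0 \<le> (a u :: real)"
    and d: "d \<in> window D" "int e \<in> window D" "d < int e" "0 < q' d"
  shows "q' (int e) = a (Suc t + e)"
proof (cases "e = D - 1")
  case True
  then show ?thesis using d upd by (auto simp: queue_update_def window_def of_nat_diff)
next
  case False
  then have e: "int e \<in> {0..int D - 2}" "int (Suc e) \<in> window D" "D > 0"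
    using d by (auto simp: window_def)
  have q'e: "q' (int e) = max 0 (q (int (Suc e)) - m (int (Suc e)))"
    using upd e unfolding queue_update_def by (simp add: add.commute)
  \<comment> \<open>What waits in \<open>d\<close> after the slot was left over, before the shift,
    in a queue \<open>d'\<close> older than \<open>Suc e\<close>; for \<open>d = -1\<close> there
    are the two sources \<open>-1\<close> and \<open>0\<close>. FIFO then denies service to
    \<open>Suc e\<close>.\<close>
  obtain d' where d': "d' \<in> window D" "d' < int (Suc e)" "m d' < q d'"
  proof (cases "d = -1")
    case True
    then have "0 < q' (-1)" using d by simp
    then have "m (-1) < q (-1) \<or> m 0 < q 0" using upd e by (auto simp: queue_update_def max_def split: if_splits)
    then show ?thesis using that[of "-1"] that[of 0] e by (auto simp: window_def)
  next
    case False
    then have "d \<in> {0..int D - 2}" using d e by (auto simp: window_def)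
    then have "m (d + 1) < q (d + 1)" using upd e d by (auto simp: queue_update_def max_def split: if_splits)
    then show ?thesis using that[of "d + 1"] d e by (auto simp: window_def)
  qed
  have "m (int (Suc e)) = 0"
    using ff m d' e unfolding fifo_def by (metis linorder_not_le order_le_less)
  moreover have "q (int (Suc e)) = a (t + Suc e)"
    using inv[OF d'(1) e(2) d'(2)] d' m by (metis le_less_trans)
  ultimately show ?thesis using a[of "t + Suc e"] by (simp add: q'e)
qed

text \<open>Greedy service by age. The steady-state hypothesis quantifies over runs, so it says
  something about the empty start only once a run from there is known to exist; this supplies the
  slots of that run.\<close>

lemma exists_fifo_allocation:
  assumes q: "\<And>d. d \<in> window D \<Longrightarrow> 0 \<le> q d" and r: "0 \<le> r"
  shows "\<exists>m. (\<forall>d\<in>window D. 0 \<le> m d) \<and> fully_efficient D r q m \<and> fifo D q m"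
proof -
  \<comment> \<open>\<open>P d\<close> is the work older than \<open>d\<close> and
    \<open>u d\<close> the greedy share. Rate exceeding all work is charged to the oldest index
    \<open>-1\<close>, so that the allocation sums to \<open>r\<close> without disturbing
    FIFO.\<close>
  define P where "P d = (\<Sum>e\<in>{-1..<d}. q e)" for d
  define u where "u d = min (q d) (max 0 (r - P d))" for d
  define m where "m d = u d + (if d = -1 then max 0 (r - P (int D)) else 0)" for d
  have PD: "P (int D) = (\<Sum>d\<in>window D. q d)"
    by (simp add: P_def window_def)
  have Pmono: "P d + q d \<le> P e" if "d \<in> window D" "e \<le> int D" "d < e" for d e
  proof -
    have "P d + q d = sum q {-1..<d+1}"
    proof -
      have "{-1..<d+1} = insert d {-1..<d}" using that by (auto simp: window_def)
      then show ?thesis by (simp add: P_def)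
    qed
    also have "\<dots> \<le> P e" unfolding P_def
      by (rule sum_mono2) (use that q in \<open>auto simp: window_def\<close>)
    finally show ?thesis .
  qed
  have usum: "(\<Sum>d\<in>{-1..<k}. u d) = min r (P k)" if "-1 \<le> k" "k \<le> int D" for k
    using that
  proof (induction k rule: int_ge_induct)
    case base then show ?case using r by (simp add: P_def)
  next
    case (step i)
    have *: "{-1..<i+1} = insert i {-1..<i}" using step by auto
    have "P (i + 1) = P i + q i" unfolding P_def * by simp
    moreover have "0 \<le> q i" using q[of i] step by (simp add: window_def)
    moreover have "(\<Sum>d\<in>{-1..<i+1}. u d) = min r (P i) + u i"
      unfolding * using step by simp
    ultimately show ?case unfolding u_def by auto
  qed
  have msum: "(\<Sum>d\<in>window D. m d) = r"
  proof -
    have "(\<Sum>d\<in>window D. m d) = (\<Sum>d\<in>window D. u d) + max 0 (r - P (int D))"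
      unfolding m_def by (simp add: sum.distrib)
    then show ?thesis using usum[of "int D"] by (simp add: window_def)
  qed
  have unn: "0 \<le> u d" "u d \<le> q d" if "d \<in> window D" for d
    using q[OF that] by (auto simp: u_def)
  have uq: "u d = q d" if "d \<in> window D" "P d + q d \<le> r" for d
    using q[OF that(1)] that(2) by (auto simp: u_def)
  have "fully_efficient D r q m"
    unfolding fully_efficient_def
  proof (intro conjI msum ballI impI)
    fix d d' assume d: "d \<in> window D" "q d < m d" and d': "d' \<in> window D - {d}"
    \<comment> \<open>Since \<open>u d \<le> q d\<close>, overservice can come only from the surplus
      at \<open>-1\<close>, and a surplus means that the rate covers all the work.\<close>
    have "P (int D) < r" using d unn[of d] by (auto simp: m_def split: if_splits)
    moreover have "P d' + q d' \<le> P (int D)" using d' by (intro Pmono) (auto simp: window_def)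
    ultimately show "q d' \<le> m d'" using uq[of d'] d' by (auto simp: m_def)
  qed
  moreover have "fifo D q m"
    unfolding fifo_def
  proof (intro ballI impI)
    fix d d' assume d: "d \<in> window D" "0 < m d" and d': "d' \<in> window D" "d' < d"
    have "0 < u d" using d d' by (auto simp: m_def window_def)
    then have "P d \<le> r" by (auto simp: u_def)
    moreover have "P d' + q d' \<le> P d" using d' d by (intro Pmono) (auto simp: window_def)
    ultimately have "u d' = q d'" using uq[of d'] d' by auto
    then show "q d' \<le> m d'" by (auto simp: m_def)
  qed
  moreover have "\<forall>d\<in>window D. 0 \<le> m d" using unn by (auto simp: m_def)
  ultimately show ?thesis by blast
qed

lemma exists_queue_update: "\<exists>q'. queue_update D a m q q'"
proof (cases "D = 0")
  case True then show ?thesis by (auto simp: queue_update_def intro!: exI[of _ "\<lambda>_. _"])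
next
  case False
  then show ?thesis
    by (intro exI[of _ "\<lambda>d. if d = -1 then max 0 (q (-1) - m (-1)) + max 0 (q 0 - m 0)
       else if d = int D - 1 then a else max 0 (q (d + 1) - m (d + 1))"])
      (auto simp: queue_update_def)
qed

text \<open>If the backlog is positive, contiguity leaves every future arrival untouched, so the
  total is the backlog plus all arrivals of the window. Otherwise the right-hand side, being
  nonnegative, suffices.\<close>

lemma fifo_backlog_le:
  fixes a :: "nat \<Rightarrow> real"
  assumes step: "\<And>t. \<exists>m. (\<forall>d\<in>window D. 0 \<le> m d) \<and> fully_efficient D (r t) (q t) m \<and>
      fifo D (q t) m \<and> queue_update D (a (t + D)) m (q t) (q (Suc t))"
    and start: "q 0 (-1) = 0" "\<And>d. d < D \<Longrightarrow> q 0 (int d) = a d"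
    and a: "\<And>u. 0 \<le> a u"
  shows "q t (-1) \<le> max 0 ((\<Sum>d\<in>window D. q t d) - (\<Sum>d<D. a (t + d)))"
proof (cases "0 < q t (-1)")
  case True
  have inv: "q t (int e) = a (t + e)"
    if "d \<in> window D" "int e \<in> window D" "d < int e" "0 < q t d" for d e
    using that
  proof (induction t arbitrary: d e)
    case 0
    then show ?case using start by (auto simp: window_def)
  next
    case (Suc t)
    obtain m where "\<forall>d\<in>window D. 0 \<le> m d" "fifo D (q t) m" "queue_update D (a (t + D)) m (q t) (q (Suc t))"
      using step by blast
    then show ?case using fifo_untouched_step Suc a by blast
  qed
  have "(\<Sum>d<D. q t (int d)) = (\<Sum>d<D. a (t + d))"
    using inv[of "-1"] True by (intro sum.cong) (auto simp: window_def)
  then show ?thesis by (simp add: sum_window)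
qed simp

section \<open>Independence\<close>

context prob_space
begin

text \<open>A form of the product rule suited to regrouping: events are set comprehensions and
  \<open>J\<close> may be empty, so index sets can be cut into pieces without case
  distinctions.\<close>

lemma indep_vars_iff_prob:
  "indep_vars N X I \<longleftrightarrow> (\<forall>i\<in>I. random_variable (N i) (X i)) \<and>
     (\<forall>J B. J \<subseteq> I \<longrightarrow> finite J \<longrightarrow> (\<forall>i\<in>J. B i \<in> sets (N i)) \<longrightarrow>
        prob {\<omega>\<in>space M. \<forall>i\<in>J. X i \<omega> \<in> B i} = (\<Prod>i\<in>J. prob {\<omega>\<in>space M. X i \<omega> \<in> B i}))"
    (is "?L \<longleftrightarrow> ?R")
proof
  assume L: ?L
  have "prob {\<omega>\<in>space M. \<forall>i\<in>J. X i \<omega> \<in> B i} = (\<Prod>i\<in>J. prob {\<omega>\<in>space M. X i \<omega> \<in> B i})"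
    if "J \<subseteq> I" "finite J" "\<forall>i\<in>J. B i \<in> sets (N i)" for J B
  proof (cases "J = {}")
    case True
    then show ?thesis by (simp add: prob_space)
  next
    case False
    have "prob (\<Inter>i\<in>J. X i -` B i \<inter> space M) = (\<Prod>i\<in>J. prob (X i -` B i \<inter> space M))"
      using indep_varsD[OF L, of J B] that False by auto
    moreover have "(\<Inter>i\<in>J. X i -` B i \<inter> space M) = {\<omega>\<in>space M. \<forall>i\<in>J. X i \<omega> \<in> B i}"
      using False by auto
    moreover have "X i -` B i \<inter> space M = {\<omega>\<in>space M. X i \<omega> \<in> B i}" for i
      by auto
    ultimately show ?thesis by simp
  qed
  then show ?R using L by (auto simp: indep_vars_def2)
next
  assume R: ?R
  show ?L
    unfolding indep_vars_def2
  proof (intro conjI indep_setsI)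
    show "\<forall>i\<in>I. random_variable (N i) (X i)" using R by blast
    show "{X i -` A \<inter> space M |A. A \<in> sets (N i)} \<subseteq> events" if "i \<in> I" for i
      using R that by (auto intro: measurable_sets)
    fix A J assume J: "J \<noteq> {}" "J \<subseteq> I" "finite J"
      "\<forall>i\<in>J. A i \<in> {X i -` A \<inter> space M |A. A \<in> sets (N i)}"
    then have "\<forall>i\<in>J. \<exists>B. A i = X i -` B \<inter> space M \<and> B \<in> sets (N i)" by blast
    then obtain B where B: "\<And>i. i \<in> J \<Longrightarrow> A i = X i -` B i \<inter> space M" "\<And>i. i \<in> J \<Longrightarrow> B i \<in> sets (N i)"
      by metis
    have "(\<Inter>i\<in>J. A i) = {\<omega>\<in>space M. \<forall>i\<in>J. X i \<omega> \<in> B i}"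
      using B(1) J(1) by auto
    then have "prob (\<Inter>i\<in>J. A i) = (\<Prod>i\<in>J. prob {\<omega>\<in>space M. X i \<omega> \<in> B i})"
      using R J B(2) by simp
    also have "\<dots> = (\<Prod>i\<in>J. prob (A i))"
      using B(1) by (intro prod.cong arg_cong[where f=prob]) auto
    finally show "prob (\<Inter>i\<in>J. A i) = (\<Prod>i\<in>J. prob (A i))" .
  qed
qed

lemma indep_vars_probD:
  assumes "indep_vars N X I" "J \<subseteq> I" "finite J" "\<And>i. i \<in> J \<Longrightarrow> B i \<in> sets (N i)"
  shows "prob {\<omega>\<in>space M. \<forall>i\<in>J. X i \<omega> \<in> B i} = (\<Prod>i\<in>J. prob {\<omega>\<in>space M. X i \<omega> \<in> B i})"
  using assms unfolding indep_vars_iff_prob by blast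

lemma indep_vars_reindex_inj:
  fixes g :: "'d \<Rightarrow> 'b"
  assumes "indep_vars (\<lambda>_. N) X UNIV" "inj g"
  shows "indep_vars (\<lambda>_. N) (\<lambda>i. X (g i)) UNIV"
  unfolding indep_vars_iff_prob
proof (intro conjI allI impI)
  show "\<forall>i\<in>UNIV. random_variable N (X (g i))" using assms(1) by (simp add: indep_vars_iff_prob)
  fix J :: "'d set" and B assume J: "finite J" "\<forall>i\<in>J. B i \<in> sets N"
  have g: "inv g (g i) = i" for i using assms(2) by simp
  have "prob {\<omega>\<in>space M. \<forall>k\<in>g ` J. X k \<omega> \<in> B (inv g k)}
      = (\<Prod>k\<in>g ` J. prob {\<omega>\<in>space M. X k \<omega> \<in> B (inv g k)})"
    by (rule indep_vars_probD[OF assms(1)]) (use J in \<open>auto simp: g\<close>)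
  then show "prob {\<omega>\<in>space M. \<forall>i\<in>J. X (g i) \<omega> \<in> B i} = (\<Prod>i\<in>J. prob {\<omega>\<in>space M. X (g i) \<omega> \<in> B i})"
    by (simp add: g prod.reindex[OF inj_on_subset[OF assms(2)]])
qed

text \<open>All constraints on slot \<open>t\<close> are collected in one measurable set
  \<open>C t\<close>. Independence of the slots separates the sets \<open>C t\<close>, and
  independence inside each slot then separates its constraints.\<close>

lemma indep_vars_nested:
  assumes X: "indep_vars (\<lambda>_. N) X UNIV"
    and \<phi>: "\<And>j. \<phi> j \<in> N \<rightarrow>\<^sub>M K"
    and nested: "\<And>t. indep_vars (\<lambda>_. K) (\<lambda>j \<omega>. \<phi> j (X t \<omega>)) UNIV"
  shows "indep_vars (\<lambda>_. K) (\<lambda>(t, j) \<omega>. \<phi> j (X t \<omega>)) UNIV"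
  unfolding indep_vars_iff_prob
proof (intro conjI allI impI)
  show "\<forall>p\<in>UNIV. random_variable K ((\<lambda>(t, j) \<omega>. \<phi> j (X t \<omega>)) p)"
    using nested by (auto simp: indep_vars_iff_prob)
  fix J :: "('b \<times> 'd) set" and B
  assume J: "finite J" "\<forall>p\<in>J. B p \<in> sets K"
  define T where "T = fst ` J"
  define Jt where "Jt t = {j. (t, j) \<in> J}" for t
  have fin: "finite T" "finite (Jt t)" for t
    using J(1) finite_subset[of "Jt t" "snd ` J"] by (force simp: T_def Jt_def)+
  have JS: "J = Sigma T Jt" by (force simp: T_def Jt_def)
  define C where "C t = {x\<in>space N. \<forall>j\<in>Jt t. \<phi> j x \<in> B (t, j)}" for t
  have C: "C t \<in> sets N" for t
  proof -
    have "{x\<in>space N. \<phi> j x \<in> B (t, j)} \<in> sets N" if "j \<in> Jt t" for j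
      using measurable_sets[OF \<phi>, of "B (t, j)" j] J(2) that
      by (auto simp: Jt_def vimage_def Int_def conj_commute)
    then show ?thesis unfolding C_def by (intro sets.sets_Collect_finite_All fin)
  qed
  have Xs: "X t \<omega> \<in> space N" if "\<omega> \<in> space M" for t \<omega>
    using X that unfolding indep_vars_iff_prob by (meson UNIV_I measurable_space)
  have "prob {\<omega>\<in>space M. \<forall>p\<in>J. (\<lambda>(t, j) \<omega>. \<phi> j (X t \<omega>)) p \<omega> \<in> B p} = prob {\<omega>\<in>space M. \<forall>t\<in>T. X t \<omega> \<in> C t}"
    by (rule arg_cong[where f=prob]) (auto simp: JS C_def Xs)
  also have "\<dots> = (\<Prod>t\<in>T. prob {\<omega>\<in>space M. X t \<omega> \<in> C t})"
    using X fin C unfolding indep_vars_iff_prob by simp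
  also have "\<dots> = (\<Prod>t\<in>T. prob {\<omega>\<in>space M. \<forall>j\<in>Jt t. \<phi> j (X t \<omega>) \<in> B (t, j)})"
    by (intro prod.cong arg_cong[where f=prob]) (auto simp: C_def Xs)
  also have "\<dots> = (\<Prod>t\<in>T. \<Prod>j\<in>Jt t. prob {\<omega>\<in>space M. \<phi> j (X t \<omega>) \<in> B (t, j)})"
    by (intro prod.cong refl indep_vars_probD[OF nested]) (use fin J(2) in \<open>auto simp: Jt_def\<close>)
  also have "\<dots> = (\<Prod>p\<in>J. prob {\<omega>\<in>space M. (\<lambda>(t, j) \<omega>. \<phi> j (X t \<omega>)) p \<omega> \<in> B p})"
    unfolding JS by (subst prod.Sigma) (auto simp: fin intro!: prod.cong)
  finally show "prob {\<omega>\<in>space M. \<forall>p\<in>J. (\<lambda>(t, j) \<omega>. \<phi> j (X t \<omega>)) p \<omega> \<in> B p}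
      = (\<Prod>p\<in>J. prob {\<omega>\<in>space M. (\<lambda>(t, j) \<omega>. \<phi> j (X t \<omega>)) p \<omega> \<in> B p})" .
qed

text \<open>The sigma-algebra of the variables with index in \<open>J\<close>, packaged as a measure
  so that \<open>\<rightarrow>\<^sub>M\<close> and its composition rules express dependence on these
  variables alone.\<close>

definition generated :: "('i \<Rightarrow> 'b measure) \<Rightarrow> ('i \<Rightarrow> 'a \<Rightarrow> 'b) \<Rightarrow> 'i set \<Rightarrow> 'a measure" where
  "generated N Y J = sigma (space M) (\<Union>i\<in>J. {Y i -` B \<inter> space M |B. B \<in> sets (N i)})"

lemma space_generated [simp]: "space (generated N Y J) = space M"
  unfolding generated_def by (rule space_measure_of) auto

lemma sets_generated:
  "sets (generated N Y J) = sigma_sets (space M) (\<Union>i\<in>J. {Y i -` B \<inter> space M |B. B \<in> sets (N i)})"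
  unfolding generated_def by (rule sets_measure_of) auto

lemma measurable_generated:
  assumes "i \<in> J" "random_variable (N i) (Y i)"
  shows "Y i \<in> generated N Y J \<rightarrow>\<^sub>M N i"
  using assms measurable_space[OF assms(2)]
  by (intro measurableI) (auto simp: sets_generated)

lemma measurable_generated_mono:
  assumes "X \<in> generated N Y J \<rightarrow>\<^sub>M L" "J \<subseteq> J'"
  shows "X \<in> generated N Y J' \<rightarrow>\<^sub>M L"
proof (rule measurable_mono[THEN subsetD, OF order_refl refl _ _ assms(1)])
  show "sets (generated N Y J) \<subseteq> sets (generated N Y J')"
    unfolding sets_generated using assms(2) by (intro sigma_sets_mono') auto
qed simp

lemma sigma_sets_vimage_generated:
  assumes "Z \<in> generated N Y I \<rightarrow>\<^sub>M K"
  shows "sigma_sets (space M) {Z -` B \<inter> space M |B. B \<in> sets K} \<subseteq> sets (generated N Y I)"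
proof -
  have "sigma_sets (space (generated N Y I)) {Z -` B \<inter> space M |B. B \<in> sets K} \<subseteq> sets (generated N Y I)"
    using measurable_sets[OF assms] by (intro sets.sigma_sets_subset) auto
  then show ?thesis by simp
qed

text \<open>The two blocks form a family over \<open>bool\<close>. The generating preimages are
  stable under intersection, which lets independence pass to the generated sigma-algebras.\<close>

lemma indep_set_generated:
  assumes Y: "indep_vars N Y UNIV" and disj: "J \<inter> J' = {}"
  shows "indep_set (sets (generated N Y J)) (sets (generated N Y J'))"
proof -
  let ?E = "\<lambda>i. {Y i -` B \<inter> space M |B. B \<in> sets (N i)}"
  have "indep_sets (\<lambda>b. sigma_sets (space M) (\<Union>i\<in>(case b of True \<Rightarrow> J | False \<Rightarrow> J'). ?E i)) UNIV"
  proof (rule indep_sets_collect_sigma)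
    show "indep_sets ?E (\<Union>b\<in>UNIV. case b of True \<Rightarrow> J | False \<Rightarrow> J')"
      using Y unfolding indep_vars_def2 by (auto elim: indep_sets_mono_index[rotated])
    show "disjoint_family_on (\<lambda>b. case b of True \<Rightarrow> J | False \<Rightarrow> J') UNIV"
      using disj by (auto simp: disjoint_family_on_def split: bool.split)
    show "Int_stable (?E i)" for i
      unfolding Int_stable_def by (auto, rule_tac x="B \<inter> Ba" in exI) auto
  qed
  moreover have "(\<lambda>b. sigma_sets (space M) (\<Union>i\<in>(case b of True \<Rightarrow> J | False \<Rightarrow> J'). ?E i))
      = case_bool (sets (generated N Y J)) (sets (generated N Y J'))"
    unfolding sets_generated by (rule ext) (simp split: bool.split)
  ultimately show ?thesis
    unfolding indep_set_def by simp
qed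

lemma indep_var_generated:
  assumes "indep_vars N Y UNIV" "J \<inter> J' = {}"
    and X: "X \<in> generated N Y J \<rightarrow>\<^sub>M L" and X': "X' \<in> generated N Y J' \<rightarrow>\<^sub>M L'"
  shows "indep_var L X L' X'"
proof -
  note ind = indep_set_generated[OF assms(1,2)]
  then have ev: "sets (generated N Y J) \<subseteq> events" "sets (generated N Y J') \<subseteq> events"
    by (simp_all add: indep_sets2_eq)
  have "random_variable L X" "random_variable L' X'"
    using X X' ev by (auto simp: measurable_def)
  then show ?thesis
    unfolding indep_var_eq using ind sigma_sets_vimage_generated[OF X] sigma_sets_vimage_generated[OF X']
    unfolding indep_sets2_eq by (meson subset_trans subsetD ev)
qed

lemma distr_Pair_eq:
  assumes [measurable]: "random_variable L X" "random_variable L' X'"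
    and prod: "\<And>B B'. B \<in> sets L \<Longrightarrow> B' \<in> sets L' \<Longrightarrow>
      prob {\<omega>\<in>space M. X \<omega> \<in> B \<and> X' \<omega> \<in> B'} = prob {\<omega>\<in>space M. X \<omega> \<in> B} * prob {\<omega>\<in>space M. X' \<omega> \<in> B'}"
  shows "distr M (L \<Otimes>\<^sub>M L') (\<lambda>\<omega>. (X \<omega>, X' \<omega>)) = distr M L X \<Otimes>\<^sub>M distr M L' X'"
proof (rule pair_measure_eqI[symmetric])
  interpret X: prob_space "distr M L X" by (rule prob_space_distr) fact
  interpret X': prob_space "distr M L' X'" by (rule prob_space_distr) fact
  show "sigma_finite_measure (distr M L X)" "sigma_finite_measure (distr M L' X')"
    by unfold_locales
  fix B B' assume "B \<in> sets (distr M L X)" "B' \<in> sets (distr M L' X')"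
  then have [measurable]: "B \<in> sets L" "B' \<in> sets L'" by auto
  have *: "(\<lambda>\<omega>. (X \<omega>, X' \<omega>)) -` (B \<times> B') \<inter> space M = {\<omega>\<in>space M. X \<omega> \<in> B \<and> X' \<omega> \<in> B'}"
    "X -` B \<inter> space M = {\<omega>\<in>space M. X \<omega> \<in> B}" "X' -` B' \<inter> space M = {\<omega>\<in>space M. X' \<omega> \<in> B'}"
    by auto
  show "emeasure (distr M L X) B * emeasure (distr M L' X') B'
      = emeasure (distr M (L \<Otimes>\<^sub>M L') (\<lambda>\<omega>. (X \<omega>, X' \<omega>))) (B \<times> B')"
    by (simp add: emeasure_distr * emeasure_eq_measure prod ennreal_mult''[symmetric])
qed simp

text \<open>Independence as a statement on joint laws, for variables whose values may have different
  types, as a queue vector and a slot input do.\<close>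

lemma distr_Pair_generated:
  assumes "indep_vars N Y UNIV" "J \<inter> J' = {}"
    and X: "X \<in> generated N Y J \<rightarrow>\<^sub>M L" and X': "X' \<in> generated N Y J' \<rightarrow>\<^sub>M L'"
  shows "distr M (L \<Otimes>\<^sub>M L') (\<lambda>\<omega>. (X \<omega>, X' \<omega>)) = distr M L X \<Otimes>\<^sub>M distr M L' X'"
proof (rule distr_Pair_eq)
  note ind = indep_set_generated[OF assms(1,2)]
  then have ev: "sets (generated N Y J) \<subseteq> events" "sets (generated N Y J') \<subseteq> events"
    by (simp_all add: indep_sets2_eq)
  then show "random_variable L X" "random_variable L' X'"
    using X X' by (auto simp: measurable_def)
  fix B B' assume B: "B \<in> sets L" "B' \<in> sets L'"
  have "X -` B \<inter> space M \<in> sets (generated N Y J)" "X' -` B' \<inter> space M \<in> sets (generated N Y J')"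
    using measurable_sets[OF X B(1)] measurable_sets[OF X' B(2)] by simp_all
  from indep_setD[OF ind this]
  show "prob {\<omega>\<in>space M. X \<omega> \<in> B \<and> X' \<omega> \<in> B'} = prob {\<omega>\<in>space M. X \<omega> \<in> B} * prob {\<omega>\<in>space M. X' \<omega> \<in> B'}"
    by (simp add: vimage_def Int_def conj_ac)
qed

end

section \<open>Splitting a slot into components and shifting them\<close>

abbreviation (input) arrival_channel :: "((real ^ 'n) \<times> 's) measure" where
  "arrival_channel \<equiv> borel \<Otimes>\<^sub>M count_space UNIV"

text \<open>The independent pieces of a slot: \<open>Some d\<close> selects the arrivals of the users with window
  \<open>d\<close>, \<open>None\<close> the channel state.  The other half of each pair is a dummy.\<close>

definition component :: "('n \<Rightarrow> nat) \<Rightarrow> nat option \<Rightarrow> (real ^ 'n) \<times> 's \<Rightarrow> (real ^ 'n) \<times> 's" where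
  "component D j w = (case j of Some d \<Rightarrow> (\<chi> n. if D n = d then fst w $ n else 0, undefined)
                        | None \<Rightarrow> (0, snd w))"

lemma component_simps:
  "component D (Some d) (a, s) = (\<chi> n. if D n = d then a $ n else 0, undefined)"
  "component D None (a, s) = (0, s)"
  by (simp_all add: component_def cong: if_cong)

lemma borel_measurable_vec_lambda [measurable (raw)]:
  fixes g :: "'b \<Rightarrow> 'n::finite \<Rightarrow> real"
  assumes "\<And>n. (\<lambda>x. g x n) \<in> borel_measurable N"
  shows "(\<lambda>x. (\<chi> n. g x n) :: real ^ 'n) \<in> borel_measurable N"
proof (rule borel_measurable_euclidean_space[THEN iffD2, rule_format])
  fix i :: "real ^ 'n" assume "i \<in> Basis"
  then obtain k where "i = axis k 1" by (auto simp: Basis_vec_def)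
  then show "(\<lambda>x. (\<chi> n. g x n) \<bullet> i) \<in> borel_measurable N"
    using assms by (simp add: cart_eq_inner_axis[symmetric])
qed

lemma borel_measurable_nth_comp [measurable (raw)]:
  fixes g :: "'b \<Rightarrow> real ^ 'n::finite"
  assumes "g \<in> borel_measurable N"
  shows "(\<lambda>x. g x $ n) \<in> borel_measurable N"
  using assms by (rule measurable_compose[OF _ borel_measurable_nth])

lemma measurable_component [measurable]:
  "component D j \<in> arrival_channel \<rightarrow>\<^sub>M arrival_channel"
  unfolding component_def by (cases j) auto

context slotted_system
begin

lemma random_slot [measurable]: "(\<lambda>\<omega>. (A t \<omega>, S t \<omega>)) \<in> M \<rightarrow>\<^sub>M arrival_channel"
  using indep_slots by (simp add: indep_vars_iff_prob)

lemma random_arrival [measurable]: "A t \<in> borel_measurable M"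
  using measurable_fst'[OF random_slot, of t] by simp

lemma random_channel [measurable]: "S t \<in> M \<rightarrow>\<^sub>M count_space UNIV"
  using measurable_snd'[OF random_slot, of t] by simp

lemma prob_arrival_channel:
  assumes "B \<in> sets borel"
  shows "prob {\<omega>\<in>space M. A t \<omega> \<in> B \<and> S t \<omega> \<in> C}
       = prob {\<omega>\<in>space M. A t \<omega> \<in> B} * prob {\<omega>\<in>space M. S t \<omega> \<in> C}"
proof -
  note [measurable] = assms
  have "prob {\<omega>\<in>space M. A t \<omega> \<in> B \<and> S t \<omega> \<in> C}
      = prob (\<Union>s\<in>C. {\<omega>\<in>space M. A t \<omega> \<in> B \<and> S t \<omega> = s})"
    by (rule arg_cong[where f=prob]) auto
  also have "\<dots> = (\<Sum>s\<in>C. prob {\<omega>\<in>space M. A t \<omega> \<in> B \<and> S t \<omega> = s})"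
    by (rule finite_measure_finite_Union) (auto simp: disjoint_family_on_def)
  also have "\<dots> = prob {\<omega>\<in>space M. A t \<omega> \<in> B} * (\<Sum>s\<in>C. prob {\<omega>\<in>space M. S t \<omega> = s})"
    by (simp add: indep_arrival_channel[OF assms] sum_distrib_left)
  also have "(\<Sum>s\<in>C. prob {\<omega>\<in>space M. S t \<omega> = s}) = prob (\<Union>s\<in>C. {\<omega>\<in>space M. S t \<omega> = s})"
    by (rule finite_measure_finite_Union[symmetric]) (auto simp: disjoint_family_on_def)
  also have "(\<Union>s\<in>C. {\<omega>\<in>space M. S t \<omega> = s}) = {\<omega>\<in>space M. S t \<omega> \<in> C}"
    by auto
  finally show ?thesis .
qed

text \<open>Identical laws are given for arrivals and channel states separately. Independence within
  the slot makes the joint law the product of these two marginals, neither of which depends on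
  \<open>t\<close>.\<close>

lemma distr_slot:
  "distr M arrival_channel (\<lambda>\<omega>. (A t \<omega>, S t \<omega>)) = distr M borel (A 0) \<Otimes>\<^sub>M distr M (count_space UNIV) (S 0)"
proof -
  have "distr M arrival_channel (\<lambda>\<omega>. (A t \<omega>, S t \<omega>)) = distr M borel (A t) \<Otimes>\<^sub>M distr M (count_space UNIV) (S t)"
    by (rule distr_Pair_eq) (auto simp: prob_arrival_channel)
  moreover have "distr M (count_space UNIV) (S t) = distr M (count_space UNIV) (S 0)"
    by (rule measure_eqI_finite[where A=UNIV])
      (auto simp: emeasure_distr emeasure_eq_measure vimage_def Int_def conj_commute channel_prob)
  ultimately show ?thesis by (simp add: arrivals_identical[of t])
qed

text \<open>Two independences are combined: between the window groups of the arrivals, and between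
  arrivals and channel. The index set is cut into its \<open>Some\<close> part \<open>J'\<close> and
  its possible \<open>None\<close> part \<open>K\<close>; \<open>E\<close> strips the dummy state
  from the constraints, and \<open>C\<close> is everything when \<open>None\<close> is
  absent.\<close>

lemma indep_components:
  assumes "independent_across_windows M A D"
  shows "indep_vars (\<lambda>_. arrival_channel) (\<lambda>j \<omega>. component D j (A t \<omega>, S t \<omega>)) UNIV"
  unfolding indep_vars_iff_prob
proof (intro conjI allI impI)
  show "\<forall>j\<in>UNIV. random_variable arrival_channel (\<lambda>\<omega>. component D j (A t \<omega>, S t \<omega>))"
    by auto
  fix J :: "nat option set" and B :: "nat option \<Rightarrow> ((real ^ 'n) \<times> 's) set"
  assume J: "finite J" "\<forall>j\<in>J. B j \<in> sets arrival_channel"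
  define J' where "J' = {d. Some d \<in> J}"
  define g :: "nat \<Rightarrow> real ^ 'n \<Rightarrow> real ^ 'n" where "g d a = (\<chi> n. if D n = d then a $ n else 0)" for d a
  define E where "E d = {a. (a, undefined) \<in> B (Some d)}" for d
  define C where "C = {s. None \<in> J \<longrightarrow> (0, s) \<in> B None}"
  have fin: "finite J'"
    using J(1) finite_vimageI[of J Some] by (simp add: J'_def vimage_def)
  have E: "E d \<in> sets borel" if "d \<in> J'" for d
  proof -
    have "(\<lambda>a. (a, undefined)) -` B (Some d) \<inter> space borel \<in> sets borel"
      by (rule measurable_sets[where A = arrival_channel]) (use J(2) that in \<open>auto simp: J'_def\<close>)
    then show ?thesis by (simp add: E_def vimage_def)
  qed
  have g [measurable]: "g d \<in> borel_measurable borel" for d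
    unfolding g_def by measurable
  have ind: "indep_vars (\<lambda>_. borel) (\<lambda>d \<omega>. g d (A t \<omega>)) UNIV"
    using assms unfolding independent_across_windows_def g_def by blast
  define K where "K = (if None \<in> J then {None :: nat option} else {})"
  have JU: "J = Some ` J' \<union> K"
  proof (rule set_eqI)
    show "j \<in> J \<longleftrightarrow> j \<in> Some ` J' \<union> K" for j
      by (cases j) (auto simp: J'_def K_def)
  qed
  have "{\<omega>\<in>space M. \<forall>j\<in>J. component D j (A t \<omega>, S t \<omega>) \<in> B j}
      = {\<omega>\<in>space M. A t \<omega> \<in> (\<Inter>d\<in>J'. g d -` E d) \<and> S t \<omega> \<in> C}"
    by (subst JU) (auto simp: component_simps g_def E_def C_def K_def)
  also have "prob \<dots> = prob {\<omega>\<in>space M. A t \<omega> \<in> (\<Inter>d\<in>J'. g d -` E d)} * prob {\<omega>\<in>space M. S t \<omega> \<in> C}"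
  proof (rule prob_arrival_channel)
    have "{a\<in>space borel. \<forall>d\<in>J'. g d a \<in> E d} \<in> sets borel"
      using E fin by (intro sets.sets_Collect_finite_All) (auto intro!: measurable_sets[OF g, of _ _, simplified vimage_def, simplified])
    then show "(\<Inter>d\<in>J'. g d -` E d) \<in> sets borel"
      by (simp add: vimage_def INTER_eq)
  qed
  also have "prob {\<omega>\<in>space M. A t \<omega> \<in> (\<Inter>d\<in>J'. g d -` E d)}
      = (\<Prod>d\<in>J'. prob {\<omega>\<in>space M. g d (A t \<omega>) \<in> E d})"
    using indep_vars_probD[OF ind, of J' E] fin E by simp
  also have "\<dots> = (\<Prod>j\<in>Some ` J'. prob {\<omega>\<in>space M. component D j (A t \<omega>, S t \<omega>) \<in> B j})"
    by (subst prod.reindex) (auto simp: component_simps g_def E_def)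
  also have "prob {\<omega>\<in>space M. S t \<omega> \<in> C}
      = (\<Prod>j\<in>K. prob {\<omega>\<in>space M. component D j (A t \<omega>, S t \<omega>) \<in> B j})"
    by (auto simp: component_simps C_def K_def prob_space)
  also have "(\<Prod>j\<in>Some ` J'. prob {\<omega>\<in>space M. component D j (A t \<omega>, S t \<omega>) \<in> B j}) * \<dots>
      = (\<Prod>j\<in>J. prob {\<omega>\<in>space M. component D j (A t \<omega>, S t \<omega>) \<in> B j})"
    unfolding arg_cong[OF JU, of "prod _"] by (rule prod.union_disjoint[symmetric]) (auto simp: fin K_def)
  finally show "prob {\<omega>\<in>space M. \<forall>j\<in>J. component D j (A t \<omega>, S t \<omega>) \<in> B j}
      = (\<Prod>j\<in>J. prob {\<omega>\<in>space M. component D j (A t \<omega>, S t \<omega>) \<in> B j})" .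
qed

definition slot_component :: "('n \<Rightarrow> nat) \<Rightarrow> nat \<times> nat option \<Rightarrow> 'w \<Rightarrow> (real ^ 'n) \<times> 's" where
  "slot_component D = (\<lambda>(t, j) \<omega>. component D j (A t \<omega>, S t \<omega>))"

lemma indep_slot_components:
  assumes "independent_across_windows M A D"
  shows "indep_vars (\<lambda>_. arrival_channel) (slot_component D) UNIV"
  unfolding slot_component_def
  by (rule indep_vars_nested[OF indep_slots measurable_component indep_components[OF assms]])

lemma random_slot_component [measurable]: "slot_component D p \<in> M \<rightarrow>\<^sub>M arrival_channel"
  by (cases p) (simp add: slot_component_def)

text \<open>The input of slot \<open>t\<close> when each component is taken with its own lookahead: zero for
  Backpressure, the window for the predictive system.\<close>

definition input :: "('n \<Rightarrow> nat) \<Rightarrow> (nat option \<Rightarrow> nat) \<Rightarrow> nat \<Rightarrow> 'w \<Rightarrow> (real ^ 'n) \<times> 's" where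
  "input D l t \<omega> = (\<chi> n. A (t + l (Some (D n))) \<omega> $ n, S (t + l None) \<omega>)"

text \<open>Undoes the splitting: each user reads its coordinate from the component of its own
  window, whichever slot that component was taken from.\<close>

definition assemble :: "('n \<Rightarrow> nat) \<Rightarrow> (nat option \<Rightarrow> (real ^ 'n) \<times> 's) \<Rightarrow> (real ^ 'n) \<times> 's" where
  "assemble D y = (\<chi> n. fst (y (Some (D n))) $ n, snd (y None))"

lemma input_eq_assemble: "input D l t \<omega> = assemble D (\<lambda>j. slot_component D (t + l j, j) \<omega>)"
  by (simp add: input_def assemble_def slot_component_def component_simps)

lemma measurable_assemble:
  assumes "\<And>j. (\<lambda>x. y x j) \<in> N \<rightarrow>\<^sub>M arrival_channel"
  shows "(\<lambda>x. assemble D (y x)) \<in> N \<rightarrow>\<^sub>M arrival_channel"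
proof -
  note [measurable] = measurable_fst'[OF assms] measurable_snd'[OF assms]
  show ?thesis unfolding assemble_def by measurable
qed

text \<open>The pairs \<open>(t + l j, j)\<close> are distinct for distinct \<open>j\<close>, so the
  components entering an input are independent whatever slots they come from, and each marginal
  depends on \<open>j\<close> alone. The family thus has a product law free of \<open>l\<close> and
  \<open>t\<close>, which \<open>assemble\<close> carries over to the input.\<close>

lemma distr_input:
  assumes "independent_across_windows M A D"
  shows "distr M arrival_channel (input D l t) = distr M arrival_channel (input D l' t')"
proof -
  let ?P = "Pi\<^sub>M UNIV (\<lambda>_. arrival_channel) :: (nat option \<Rightarrow> (real ^ 'n) \<times> 's) measure"
  define Y where "Y l t \<omega> = (\<lambda>j. slot_component D (t + l j, j) \<omega>)" for l :: "nat option \<Rightarrow> nat" and t :: nat and \<omega>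
  have Y [measurable]: "Y l t \<in> M \<rightarrow>\<^sub>M ?P" for l t
    unfolding Y_def by (rule measurable_PiM_single') (auto simp: space_pair_measure)
  have *: "distr M ?P (Y l t) = (\<Pi>\<^sub>M j\<in>UNIV. distr M arrival_channel (slot_component D (0, j)))" for l t
  proof -
    have "indep_vars (\<lambda>_. arrival_channel) (\<lambda>j. slot_component D (t + l j, j)) UNIV"
      by (rule indep_vars_reindex_inj[OF indep_slot_components[OF assms]]) (auto intro: injI)
    then have "distr M ?P (Y l t) = (\<Pi>\<^sub>M j\<in>UNIV. distr M arrival_channel (slot_component D (t + l j, j)))"
      by (subst (asm) indep_vars_iff_distr_eq_PiM) (auto simp: Y_def[abs_def] restrict_def)
    moreover have "distr M arrival_channel (slot_component D (u, j))
        = distr (distr M arrival_channel (\<lambda>\<omega>. (A u \<omega>, S u \<omega>))) arrival_channel (component D j)" for u j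
      by (subst distr_distr) (auto simp: slot_component_def comp_def)
    ultimately show ?thesis by (simp add: distr_slot)
  qed
  have "distr M arrival_channel (input D l t) = distr (distr M ?P (Y l t)) arrival_channel (assemble D)" for l t
    by (subst distr_distr) (auto intro!: measurable_assemble simp: input_eq_assemble[abs_def] Y_def comp_def)
  then show ?thesis by (simp add: *)
qed

text \<open>The horizon depends on the component. The input of time \<open>t\<close> uses exactly
  the pairs \<open>(t + l j, j)\<close>, the first ones beyond it.\<close>

definition past :: "(nat option \<Rightarrow> nat) \<Rightarrow> nat \<Rightarrow> (nat \<times> nat option) set" where
  "past l t = {(u, j). u < t + l j}"

abbreviation history :: "('n \<Rightarrow> nat) \<Rightarrow> (nat option \<Rightarrow> nat) \<Rightarrow> nat \<Rightarrow> 'w measure" where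
  "history D l t \<equiv> generated (\<lambda>_. arrival_channel) (slot_component D) (past l t)"

lemma measurable_input_generated:
  assumes "range (\<lambda>j. (t + l j, j)) \<subseteq> J"
  shows "input D l t \<in> generated (\<lambda>_. arrival_channel) (slot_component D) J \<rightarrow>\<^sub>M arrival_channel"
  unfolding input_eq_assemble[abs_def]
  by (intro measurable_assemble measurable_generated) (use assms in auto)

lemma random_input [measurable]: "input D l t \<in> M \<rightarrow>\<^sub>M arrival_channel"
  unfolding input_eq_assemble[abs_def] by (intro measurable_assemble) auto

section \<open>Recursions driven by shifted inputs\<close>

primrec chain :: "(real ^ 'n \<Rightarrow> (real ^ 'n) \<times> 's \<Rightarrow> real ^ 'n) \<Rightarrow> ('w \<Rightarrow> real ^ 'n) \<Rightarrow>
    (nat \<Rightarrow> 'w \<Rightarrow> (real ^ 'n) \<times> 's) \<Rightarrow> nat \<Rightarrow> 'w \<Rightarrow> real ^ 'n" where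
  "chain F z W 0 \<omega> = z \<omega>"
| "chain F z W (Suc t) \<omega> = F (chain F z W t \<omega>) (W t \<omega>)"

lemma chain_measurable_history:
  assumes F: "case_prod F \<in> borel \<Otimes>\<^sub>M arrival_channel \<rightarrow>\<^sub>M borel"
    and z: "z \<in> borel_measurable (history D l 0)"
  shows "chain F z (input D l) t \<in> borel_measurable (history D l t)"
proof (induction t)
  case 0
  then show ?case using z by (simp cong: measurable_cong)
next
  case (Suc t)
  have "chain F z (input D l) t \<in> borel_measurable (history D l (Suc t))"
    by (rule measurable_generated_mono[OF Suc]) (auto simp: past_def)
  moreover have "input D l t \<in> history D l (Suc t) \<rightarrow>\<^sub>M arrival_channel"
    by (rule measurable_input_generated) (auto simp: past_def)
  ultimately have "(\<lambda>\<omega>. (chain F z (input D l) t \<omega>, input D l t \<omega>)) \<in> history D l (Suc t) \<rightarrow>\<^sub>M borel \<Otimes>\<^sub>M arrival_channel"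
    by measurable
  from measurable_compose[OF this F] show ?case by simp
qed

text \<open>The state is a function of the pairs in \<open>past l t\<close>, the input a function of
  the pairs just beyond; the two index sets are disjoint.\<close>

lemma distr_Pair_chain_input:
  assumes "independent_across_windows M A D"
    and "case_prod F \<in> borel \<Otimes>\<^sub>M arrival_channel \<rightarrow>\<^sub>M borel"
    and "z \<in> borel_measurable (history D l 0)"
  shows "distr M (borel \<Otimes>\<^sub>M arrival_channel) (\<lambda>\<omega>. (chain F z (input D l) t \<omega>, input D l t \<omega>))
     = distr M borel (chain F z (input D l) t) \<Otimes>\<^sub>M distr M arrival_channel (input D l t)"
  by (rule distr_Pair_generated[OF indep_slot_components[OF assms(1)] _ chain_measurable_history[OF assms(2,3)]
        measurable_input_generated[OF order_refl]]) (auto simp: past_def)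

lemma random_chain:
  assumes "independent_across_windows M A D"
    and "case_prod F \<in> borel \<Otimes>\<^sub>M arrival_channel \<rightarrow>\<^sub>M borel"
    and "z \<in> borel_measurable (history D l 0)"
  shows "chain F z (input D l) t \<in> borel_measurable M"
proof -
  \<comment> \<open>Independence from the complementary block is invoked for a consequence of it:
    its sigma-algebras consist of events.\<close>
  have "sets (history D l t) \<subseteq> events"
    using indep_set_generated[OF indep_slot_components[OF assms(1)], of "past l t" "- past l t"]
    by (simp add: indep_sets2_eq)
  then show ?thesis
    using chain_measurable_history[OF assms(2,3), of t] by (auto simp: measurable_def)
qed

text \<open>The law of the next state is the image under \<open>F\<close> of the product of the law
  of the state and the law of the input. The first factor is the same for both lookaheads by
  induction, the second by \<open>distr_input\<close>; the constant start anchors the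
  induction.\<close>

lemma distr_chain:
  assumes D: "independent_across_windows M A D"
    and F: "case_prod F \<in> borel \<Otimes>\<^sub>M arrival_channel \<rightarrow>\<^sub>M borel"
  shows "distr M borel (chain F (\<lambda>_. z) (input D l) t) = distr M borel (chain F (\<lambda>_. z) (input D l') t)"
proof (induction t)
  case 0
  then show ?case by (simp cong: distr_cong)
next
  case (Suc t)
  have "distr M borel (chain F (\<lambda>_. z) (input D l) (Suc t))
      = distr (distr M borel (chain F (\<lambda>_. z) (input D l) t) \<Otimes>\<^sub>M distr M arrival_channel (input D l 0)) borel (case_prod F)" for l
  proof -
    let ?X = "chain F (\<lambda>_. z) (input D l) t"
    have eq: "distr M borel ?X \<Otimes>\<^sub>M distr M arrival_channel (input D l t)
        = distr M (borel \<Otimes>\<^sub>M arrival_channel) (\<lambda>\<omega>. (?X \<omega>, input D l t \<omega>))"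
      by (rule distr_Pair_chain_input[OF D F, symmetric]) simp
    have rv: "?X \<in> borel_measurable M"
      by (rule random_chain[OF D F]) simp
    have "distr (distr M (borel \<Otimes>\<^sub>M arrival_channel) (\<lambda>\<omega>. (?X \<omega>, input D l t \<omega>))) borel (case_prod F)
        = distr M borel (chain F (\<lambda>_. z) (input D l) (Suc t))"
      using rv by (subst distr_distr[OF F]) (auto simp: comp_def intro!: distr_cong)
    then show ?thesis by (simp add: eq[symmetric] distr_input[OF D, of l t l 0])
  qed
  from this[of l] this[of l'] show ?case by (simp only: Suc distr_input[OF D, of l 0 l' 0])
qed

end

section \<open>Drift of the total queues\<close>

locale predictive_backpressure = slotted_system M A S lam p_ch PP mu f A_max P_max mu_max f_max
  for M :: "'w measure"
    and A :: "nat \<Rightarrow> 'w \<Rightarrow> real ^ 'n" and S :: "nat \<Rightarrow> 'w \<Rightarrow> 's::finite"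
    and lam p_ch PP mu f A_max P_max mu_max f_max +
  fixes V \<eta> :: real and rl :: "'s \<Rightarrow> real ^ 'n \<Rightarrow> real ^ 'n" and D :: "'n \<Rightarrow> nat"
  assumes V_pos: "0 < V"
    and rule: "backpressure_rule PP mu f V rl"
    and windows: "independent_across_windows M A D"
    and slack: "0 < \<eta>" "slack_condition lam p_ch PP mu \<eta>"
begin

lemma rule_measurable [measurable]: "rl s \<in> borel_measurable borel"
  using rule by (simp add: backpressure_rule_def)

lemma rule_in: "0 \<le> q \<Longrightarrow> rl s q \<in> PP s"
  using rule by (auto simp: backpressure_rule_def is_arg_min_def)

lemma rule_minimal:
  assumes "0 \<le> q" "P \<in> PP s"
  shows "V * f s (rl s q) - (\<Sum>n\<in>UNIV. q $ n * mu n s (rl s q)) \<le> V * f s P - (\<Sum>n\<in>UNIV. q $ n * mu n s P)"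
  using rule assms by (auto simp: backpressure_rule_def is_arg_min_def not_less)

text \<open>Cut off outside the nonnegative orthant, where the rule need not return admissible powers
  and measurability of the rate may fail.\<close>

definition rate :: "'n \<Rightarrow> 's \<Rightarrow> real ^ 'n \<Rightarrow> real" where
  "rate n s q = (if 0 \<le> q then mu n s (rl s q) else 0)"

lemma mu_max_nonneg: "0 \<le> mu_max"
  using rate_bounded[OF rule_in[of 0]] by force

lemma rate_nonneg: "0 \<le> rate n s q" and rate_le: "rate n s q \<le> mu_max"
  using rate_bounded[OF rule_in, of q] mu_max_nonneg by (auto simp: rate_def)

text \<open>\<open>mu n s\<close> is continuous only on \<open>PP s\<close>. This set is closed, so
  the extension by zero is Borel, and on the nonnegative orthant the rule never leaves it.\<close>

lemma rate_measurable [measurable]: "rate n s \<in> borel_measurable borel"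
proof -
  have "closed (PP s)" using power_compact by (rule compact_imp_closed)
  then have 1 [measurable]: "(\<lambda>P. indicator (PP s) P *\<^sub>R mu n s P) \<in> borel_measurable borel"
    by (intro borel_measurable_continuous_on_indicator rate_continuous) auto
  have 2: "rate n s q = (if \<forall>k. 0 \<le> q $ k then indicator (PP s) (rl s q) *\<^sub>R mu n s (rl s q) else 0)" for q
    using rule_in[of q s] by (auto simp: rate_def less_eq_vec_def)
  have "(\<lambda>q. indicator (PP s) (rl s q) *\<^sub>R mu n s (rl s q)) \<in> borel_measurable borel"
    by (rule measurable_compose[OF rule_measurable 1])
  then show ?thesis unfolding 2[abs_def] by measurable
qed

definition step :: "real ^ 'n \<Rightarrow> (real ^ 'n) \<times> 's \<Rightarrow> real ^ 'n" where
  "step q w = (\<chi> n. max 0 (q $ n - rate n (snd w) q) + fst w $ n)"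

lemma step_eq_mu:
  "0 \<le> q \<Longrightarrow> step q w = (\<chi> n. max 0 (q $ n - mu n (snd w) (rl (snd w) q)) + fst w $ n)"
  by (simp add: step_def rate_def)

lemma step_nth: "step q w $ n = max 0 (q $ n - rate n (snd w) q) + fst w $ n"
  by (simp add: step_def)

lemma step_measurable: "case_prod step \<in> borel \<Otimes>\<^sub>M arrival_channel \<rightarrow>\<^sub>M borel"
proof -
  have [measurable]: "(\<lambda>x :: (real ^ 'n) \<times> (real ^ 'n) \<times> 's. rate n (snd (snd x)) (fst x))
      \<in> borel_measurable (borel \<Otimes>\<^sub>M arrival_channel)" for n
    by (rule measurable_compose_countable[where f = "\<lambda>s x. rate n s (fst x)"]) measurable
  show ?thesis unfolding step_def case_prod_beta by measurable
qed

definition lookahead :: "nat option \<Rightarrow> nat" where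
  "lookahead j = (case j of Some d \<Rightarrow> d | None \<Rightarrow> 0)"

abbreviation admitted :: "nat \<Rightarrow> 'w \<Rightarrow> real ^ 'n" where
  "admitted t \<omega> \<equiv> fst (input D lookahead t \<omega>)"

lemma input_lookahead: "input D lookahead t \<omega> = (\<chi> n. A (t + D n) \<omega> $ n, S t \<omega>)"
  by (simp add: input_def lookahead_def)

lemma input_0: "input D (\<lambda>_. 0) t \<omega> = (A t \<omega>, S t \<omega>)"
  by (simp add: input_def vec_eq_iff)

lemma input_bounds: "\<omega> \<in> space M \<Longrightarrow> 0 \<le> fst (input D l t \<omega>) $ n"
  "\<omega> \<in> space M \<Longrightarrow> fst (input D l t \<omega>) $ n \<le> A_max"
  using arrivals_bounded by (auto simp: input_def)

lemma chain_nonneg: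
  assumes "\<omega> \<in> space M" "0 \<le> z \<omega>"
  shows "0 \<le> chain step z (input D l) t \<omega>"
  using assms input_bounds[OF assms(1)]
  by (cases t) (auto simp: step_def less_eq_vec_def intro!: add_nonneg_nonneg)

text \<open>Crude linear growth: for each fixed slot the queue stays in a compact box, which settles
  all integrability questions.\<close>

lemma chain_le:
  assumes "\<omega> \<in> space M" "0 \<le> z \<omega>" "\<And>n. z \<omega> $ n \<le> B"
  shows "chain step z (input D l) t \<omega> $ n \<le> B + real t * A_max"
proof (induction t)
  case 0
  then show ?case using assms by simp
next
  case (Suc t)
  let ?X = "chain step z (input D l) t \<omega>"
  have "max 0 (?X $ n - rate n (snd (input D l t \<omega>)) ?X) \<le> ?X $ n"
    using rate_nonneg[of n "snd (input D l t \<omega>)" ?X] chain_nonneg[where z = z and l = l and t = t, OF assms(1,2)] by (auto simp: less_eq_vec_def)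
  then show ?case using Suc input_bounds(2)[OF assms(1), of l t n]
    by (simp only: chain.simps step_nth of_nat_Suc distrib_right mult_1)
qed

lemma bp_queue_eq_chain:
  assumes "\<omega> \<in> space M"
  shows "bp_queue A S mu rl t \<omega> = chain step (\<lambda>_. 0) (input D (\<lambda>_. 0)) t \<omega>"
proof (induction t)
  case (Suc t)
  show ?case
    using chain_nonneg[where z = "\<lambda>_. 0" and l = "\<lambda>_. 0" and t = t, OF assms]
    by (simp add: Suc step_eq_mu input_0[abs_def])
qed simp

text \<open>The rule sees only the totals, and the totals do not depend on how the rate is split.
  All runs with the same initial totals therefore share one recursion, of Backpressure type with
  shifted arrivals.\<close>

lemma total_queue_eq_chain:
  assumes Q: "pbp_fifo_dynamics M A S mu rl D Q" and \<omega>: "\<omega> \<in> space M"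
    and z: "total_queue D (Q 0 \<omega>) = z \<omega>" "0 \<le> z \<omega>"
  shows "total_queue D (Q t \<omega>) = chain step z (input D lookahead) t \<omega>"
proof (induction t)
  case 0
  then show ?case by (simp add: z)
next
  case (Suc t)
  have "total_queue D (Q (Suc t) \<omega>) $ n
      = max 0 (total_queue D (Q t \<omega>) $ n - mu n (S t \<omega>) (rl (S t \<omega>) (total_queue D (Q t \<omega>)))) + A (t + D n) \<omega> $ n" for n
  proof -
    obtain m where "fully_efficient (D n) (mu n (S t \<omega>) (rl (S t \<omega>) (total_queue D (Q t \<omega>)))) (Q t \<omega> n) m"
        "queue_update (D n) (A (t + D n) \<omega> $ n) m (Q t \<omega> n) (Q (Suc t) \<omega> n)"
      using Q \<omega> unfolding pbp_fifo_dynamics_def by blast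
    from sum_queue_update[OF this] show ?thesis by (simp add: total_queue_def)
  qed
  then show ?case
    using chain_nonneg[where z = z and l = lookahead and t = t, OF \<omega> z(2)]
    by (simp add: vec_eq_iff Suc step_eq_mu input_lookahead[abs_def])
qed

text \<open>Dependent choice separately for each \<omega>. Nonnegativity is carried along in
  \<open>P\<close>, since the greedy allocation and the admissibility of the rule rely on it; the
  second half of \<open>P\<close> pins the initial state.\<close>

lemma exists_empty_start: "\<exists>Q. pbp_fifo_dynamics M A S mu rl D Q \<and> empty_start M D Q"
proof -
  define R where "R \<omega> t q q' \<longleftrightarrow> (\<forall>n. \<exists>m.
        (\<forall>d\<in>window (D n). 0 \<le> m d) \<and>
        fully_efficient (D n) (mu n (S t \<omega>) (rl (S t \<omega>) (total_queue D q))) (q n) m \<and>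
        fifo (D n) (q n) m \<and> queue_update (D n) (A (t + D n) \<omega> $ n) m (q n) (q' n))" for \<omega> t q q'
  define P where "P t q \<longleftrightarrow> (\<forall>n. \<forall>d\<in>window (D n). 0 \<le> q n d) \<and> (t = (0::nat) \<longrightarrow> q = (\<lambda>_ _. 0))"
    for t and q :: "'n \<Rightarrow> int \<Rightarrow> real"
  have ex: "\<exists>Q. \<forall>t. P t (Q t) \<and> R \<omega> t (Q t) (Q (Suc t))" if \<omega>: "\<omega> \<in> space M" for \<omega>
  proof (rule dependent_nat_choice)
    show "\<exists>q. P 0 q" by (auto simp: P_def)
    fix q t assume q: "P t q"
    have "0 \<le> total_queue D q"
      using q by (auto simp: P_def total_queue_def less_eq_vec_def intro!: sum_nonneg)
    then have r: "0 \<le> mu n (S t \<omega>) (rl (S t \<omega>) (total_queue D q))" for n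
      using rate_bounded rule_in by blast
    have "\<exists>m q'. (\<forall>d\<in>window (D n). 0 \<le> m d) \<and>
        fully_efficient (D n) (mu n (S t \<omega>) (rl (S t \<omega>) (total_queue D q))) (q n) m \<and>
        fifo (D n) (q n) m \<and> queue_update (D n) (A (t + D n) \<omega> $ n) m (q n) q'" for n
      using exists_fifo_allocation[OF _ r, of "D n" "q n" n] exists_queue_update q unfolding P_def by metis
    then obtain q' where q': "R \<omega> t q q'"
      unfolding R_def by metis
    moreover have "P (Suc t) q'"
      using q' queue_update_nonneg arrivals_bounded[OF \<omega>] unfolding P_def R_def by blast
    ultimately show "\<exists>q'. P (Suc t) q' \<and> R \<omega> t q q'" by blast
  qed
  then obtain Q where Q: "\<And>\<omega> t. \<omega> \<in> space M \<Longrightarrow> P t (Q \<omega> t) \<and> R \<omega> t (Q \<omega> t) (Q \<omega> (Suc t))"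
    by metis
  show ?thesis
  proof (intro exI[of _ "\<lambda>t \<omega>. Q \<omega> t"] conjI)
    show "pbp_fifo_dynamics M A S mu rl D (\<lambda>t \<omega>. Q \<omega> t)"
      using Q unfolding pbp_fifo_dynamics_def R_def by blast
    show "empty_start M D (\<lambda>t \<omega>. Q \<omega> t)"
      using Q[of _ 0] unfolding empty_start_def P_def by simp
  qed
qed

text \<open>The cost is assumed bounded only above. The lower bound comes from continuity on compact
  sets, nonempty because the rule picks a point in each, and from finiteness of the state
  space.\<close>

lemma cost_bounded_below: "\<exists>f_min. \<forall>s. \<forall>P\<in>PP s. f_min \<le> f s P"
proof -
  have "\<exists>b. \<forall>P\<in>PP s. b \<le> f s P" for s
    using continuous_attains_inf[OF power_compact _ cost_continuous, of s] rule_in[of 0 s] by auto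
  then obtain b where b: "\<And>s P. P \<in> PP s \<Longrightarrow> b s \<le> f s P" by metis
  have "Min (range b) \<le> f s P" if "P \<in> PP s" for s P
    by (rule order_trans[OF Min_le b[OF that]]) auto
  then show ?thesis by blast
qed

lemma p_ch_nonneg: "0 \<le> p_ch s"
  using channel_prob[of 0 s] measure_nonneg by metis

lemma sum_p_ch: "(\<Sum>s\<in>UNIV. p_ch s) = 1"
proof -
  have "(\<Sum>s\<in>UNIV. p_ch s) = prob (\<Union>s\<in>UNIV. {\<omega>\<in>space M. S 0 \<omega> = s})"
    unfolding channel_prob[of 0, symmetric]
    by (rule finite_measure_finite_Union[symmetric]) (auto simp: disjoint_family_on_def)
  also have "(\<Union>s\<in>UNIV. {\<omega>\<in>space M. S 0 \<omega> = s}) = space M" by auto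
  finally show ?thesis by (simp add: prob_space)
qed

text \<open>The slack powers compete in the minimization of the rule.\<close>

lemma drift_le:
  assumes f_min: "\<And>s P. P \<in> PP s \<Longrightarrow> f_min \<le> f s P" and q: "0 \<le> q"
  shows "(\<Sum>n\<in>UNIV. q $ n * (lam $ n - (\<Sum>s\<in>UNIV. p_ch s * rate n s q)))
       \<le> V * (f_max - f_min) - \<eta> * (\<Sum>n\<in>UNIV. q $ n)"
proof -
  obtain R p a where pa: "\<And>s m. m < (R::nat) \<Longrightarrow> p s m \<in> PP s" "\<And>s m. m < R \<Longrightarrow> 0 \<le> a s m"
      "\<And>s. (\<Sum>m<R. a s m) = 1"
      "\<And>n. lam $ n - (\<Sum>s\<in>UNIV. p_ch s * (\<Sum>m<R. a s m * mu n s (p s m))) \<le> - \<eta>"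
    using slack(2) unfolding slack_condition_def by blast
  define \<sigma> where "\<sigma> n s = (\<Sum>m<R. a s m * mu n s (p s m))" for n s
  have qn: "0 \<le> q $ n" for n using q by (simp add: less_eq_vec_def)
  \<comment> \<open>\<open>\<sigma>\<close> is the service of the randomized slack policy. Against
    each single slack power the rule loses at most \<open>V\<close> times the range of the cost, and
    averaging with weights of sum one preserves this.\<close>
  have 1: "(\<Sum>n\<in>UNIV. q $ n * \<sigma> n s) - (\<Sum>n\<in>UNIV. q $ n * rate n s q) \<le> V * (f_max - f_min)" for s
  proof -
    let ?r = "\<Sum>n\<in>UNIV. q $ n * rate n s q"
    have le: "(\<Sum>n\<in>UNIV. q $ n * mu n s (p s m)) - ?r \<le> V * (f_max - f_min)" if "m < R" for m
    proof -
      have "V * f s (p s m) \<le> V * f_max" "V * f_min \<le> V * f s (rl s q)"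
        using V_pos cost_bounded[OF pa(1)[OF that]] f_min[OF rule_in[OF q]] by auto
      then show ?thesis
        using rule_minimal[OF q pa(1)[OF that, of s]] q by (simp add: rate_def algebra_simps)
    qed
    have "(\<Sum>n\<in>UNIV. q $ n * \<sigma> n s) - ?r = (\<Sum>m<R. a s m * ((\<Sum>n\<in>UNIV. q $ n * mu n s (p s m)) - ?r))"
    proof -
      have "(\<Sum>n\<in>UNIV. q $ n * \<sigma> n s) = (\<Sum>m<R. a s m * (\<Sum>n\<in>UNIV. q $ n * mu n s (p s m)))"
        unfolding \<sigma>_def sum_distrib_left by (subst sum.swap) (simp add: mult_ac)
      moreover have "(\<Sum>m<R. a s m * ?r) = ?r"
        by (simp add: sum_distrib_right[symmetric] pa(3))
      ultimately show ?thesis by (simp add: right_diff_distrib sum_subtractf)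
    qed
    also have "\<dots> \<le> (\<Sum>m<R. a s m * (V * (f_max - f_min)))"
      by (intro sum_mono mult_left_mono le pa(2)) auto
    also have "\<dots> = V * (f_max - f_min)"
      by (simp only: sum_distrib_right[symmetric] pa(3) mult_1)
    finally show ?thesis .
  qed
  have "(\<Sum>n\<in>UNIV. q $ n * (\<Sum>s\<in>UNIV. p_ch s * \<sigma> n s)) - (\<Sum>n\<in>UNIV. q $ n * (\<Sum>s\<in>UNIV. p_ch s * rate n s q))
      = (\<Sum>s\<in>UNIV. p_ch s * ((\<Sum>n\<in>UNIV. q $ n * \<sigma> n s) - (\<Sum>n\<in>UNIV. q $ n * rate n s q)))"
  proof -
    have "(\<Sum>n\<in>UNIV. q $ n * (\<Sum>s\<in>UNIV. p_ch s * g n s)) = (\<Sum>s\<in>UNIV. p_ch s * (\<Sum>n\<in>UNIV. q $ n * g n s))"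
      for g :: "'n \<Rightarrow> 's \<Rightarrow> real"
      unfolding sum_distrib_left by (subst sum.swap) (simp add: mult_ac)
    then show ?thesis by (simp add: right_diff_distrib sum_subtractf)
  qed
  also have "\<dots> \<le> (\<Sum>s\<in>UNIV. p_ch s * (V * (f_max - f_min)))"
    by (intro sum_mono mult_left_mono 1 p_ch_nonneg)
  also have "\<dots> = V * (f_max - f_min)"
    by (simp only: sum_distrib_right[symmetric] sum_p_ch mult_1)
  finally have 2: "(\<Sum>n\<in>UNIV. q $ n * (\<Sum>s\<in>UNIV. p_ch s * \<sigma> n s)) - (\<Sum>n\<in>UNIV. q $ n * (\<Sum>s\<in>UNIV. p_ch s * rate n s q))
      \<le> V * (f_max - f_min)" .
  have 3: "(\<Sum>n\<in>UNIV. q $ n * (lam $ n - (\<Sum>s\<in>UNIV. p_ch s * \<sigma> n s))) \<le> (\<Sum>n\<in>UNIV. q $ n * - \<eta>)"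
    using pa(4) qn unfolding \<sigma>_def by (intro sum_mono mult_left_mono) auto
  have 4: "(\<Sum>n\<in>UNIV. q $ n * - \<eta>) = - \<eta> * (\<Sum>n\<in>UNIV. q $ n)"
    by (simp add: sum_distrib_left mult.commute sum_negf)
  show ?thesis using 2 3 unfolding 4 by (simp add: right_diff_distrib sum_subtractf)
qed

end

section \<open>Fourth-power drift and second moments\<close>

lemma sum_le_card_norm:
  fixes q :: "real ^ 'n::finite"
  shows "(\<Sum>n\<in>UNIV. q $ n) \<le> real CARD('n) * norm q"
proof -
  have "(\<Sum>n\<in>UNIV. q $ n) \<le> (\<Sum>n\<in>(UNIV :: 'n set). norm q)"
    by (intro sum_mono order_trans[OF abs_ge_self component_le_norm_cart])
  then show ?thesis by simp
qed

lemma norm_le_sum_nonneg: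
  fixes q :: "real ^ 'n::finite"
  assumes "0 \<le> q"
  shows "norm q \<le> (\<Sum>n\<in>UNIV. q $ n)"
  using norm_le_l1_cart[of q] assms by (simp add: less_eq_vec_def)

lemma square_norm_vec: "(norm (q :: real ^ 'n::finite))\<^sup>2 = (\<Sum>n\<in>UNIV. (q $ n)\<^sup>2)"
  by (simp only: power2_norm_eq_inner inner_vec_def) (simp add: power2_eq_square)

text \<open>The left side is positive only for \<open>x < k / e\<close>, where it is bounded. This
  lets the cubic negative drift absorb all quadratic terms.\<close>

lemma cubic_dominates:
  fixes x e k :: real
  assumes "0 < e" "0 \<le> k" "0 \<le> x"
  shows "x\<^sup>2 * (k - e * x) \<le> k * (k / e)\<^sup>2"
proof (cases "k \<le> e * x")
  case True
  then have "x\<^sup>2 * (k - e * x) \<le> 0" by (simp add: mult_nonneg_nonpos)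
  also have "0 \<le> k * (k / e)\<^sup>2" using assms by simp
  finally show ?thesis .
next
  case False
  then have "x \<le> k / e" using assms by (simp add: field_simps)
  then have "x\<^sup>2 \<le> (k / e)\<^sup>2" using assms by (intro power_mono) auto
  then have "x\<^sup>2 * (k - e * x) \<le> (k / e)\<^sup>2 * k"
    using False assms by (intro mult_mono) auto
  then show ?thesis by (simp add: mult.commute)
qed

context predictive_backpressure
begin

definition drift_const :: real where
  "drift_const = real CARD('n) * (A_max\<^sup>2 + mu_max\<^sup>2)"

text \<open>The squared norm grows by at most \<open>\<Delta>\<close>, and this bound is squared.
  The cross term keeps the drift to be averaged; \<open>\<Delta>\<close> itself is at most linear in
  \<open>norm q\<close>, so its square is only quadratic, one order below the cubic drift.\<close>

lemma norm_step_pow4: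
  assumes q: "0 \<le> q" and w: "\<And>n. 0 \<le> fst w $ n" "\<And>n. fst w $ n \<le> A_max"
  shows "norm (step q w) ^ 4 \<le> norm q ^ 4
     + 2 * (norm q)\<^sup>2 * (2 * (\<Sum>n\<in>UNIV. q $ n * (fst w $ n - rate n (snd w) q)) + drift_const)
     + (8 * (real CARD('n) * (A_max + mu_max))\<^sup>2 * (norm q)\<^sup>2 + 2 * drift_const\<^sup>2)"
proof -
  define r where "r n = rate n (snd w) q" for n
  define a where "a n = fst w $ n" for n
  define N where "N = real CARD('n)"
  define \<Delta> where "\<Delta> = 2 * (\<Sum>n\<in>UNIV. q $ n * (a n - r n)) + drift_const"
  have qn: "0 \<le> q $ n" and r: "0 \<le> r n" "r n \<le> mu_max" and a: "0 \<le> a n" "a n \<le> A_max" for n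
    using q rate_nonneg rate_le w by (auto simp: less_eq_vec_def r_def a_def)
  have one: "(step q w $ n)\<^sup>2 \<le> (q $ n)\<^sup>2 + 2 * (q $ n * (a n - r n)) + (A_max\<^sup>2 + mu_max\<^sup>2)" for n
  proof -
    define x where "x = max 0 (q $ n - r n)"
    have "x\<^sup>2 \<le> (q $ n - r n)\<^sup>2" unfolding x_def by (auto simp: max_def)
    moreover have "x * a n \<le> q $ n * a n"
      using qn[of n] r(1)[of n] a(1)[of n] by (intro mult_right_mono) (auto simp: x_def)
    moreover have "(a n)\<^sup>2 \<le> A_max\<^sup>2" "(r n)\<^sup>2 \<le> mu_max\<^sup>2"
      using a r by (auto intro: power_mono)
    moreover have "(step q w $ n)\<^sup>2 = x\<^sup>2 + 2 * (x * a n) + (a n)\<^sup>2"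
      by (simp add: step_nth x_def r_def a_def power2_sum)
    moreover have "(q $ n - r n)\<^sup>2 = (q $ n)\<^sup>2 - 2 * (q $ n * r n) + (r n)\<^sup>2"
      by (simp add: power2_diff)
    ultimately show ?thesis by (simp add: right_diff_distrib)
  qed
  have sq: "(norm (step q w))\<^sup>2 \<le> (norm q)\<^sup>2 + \<Delta>"
  proof -
    have "(norm (step q w))\<^sup>2 \<le> (\<Sum>n\<in>UNIV. (q $ n)\<^sup>2 + 2 * (q $ n * (a n - r n)) + (A_max\<^sup>2 + mu_max\<^sup>2))"
      unfolding square_norm_vec by (intro sum_mono one)
    also have "\<dots> = (norm q)\<^sup>2 + \<Delta>"
      by (simp add: sum.distrib square_norm_vec \<Delta>_def drift_const_def sum_distrib_left)
    finally show ?thesis .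
  qed
  have abs: "\<bar>\<Delta>\<bar> \<le> 2 * (N * (A_max + mu_max)) * norm q + drift_const"
  proof -
    have "\<bar>\<Sum>n\<in>UNIV. q $ n * (a n - r n)\<bar> \<le> (\<Sum>n\<in>UNIV. \<bar>q $ n * (a n - r n)\<bar>)"
      by (rule sum_abs)
    also have "\<dots> \<le> (\<Sum>n\<in>UNIV. q $ n * (A_max + mu_max))"
    proof (rule sum_mono)
      fix n
      have "\<bar>a n - r n\<bar> \<le> A_max + mu_max" using a[of n] r[of n] by linarith
      then show "\<bar>q $ n * (a n - r n)\<bar> \<le> q $ n * (A_max + mu_max)"
        using qn[of n] by (simp add: abs_mult mult_left_mono)
    qed
    also have "\<dots> = (A_max + mu_max) * (\<Sum>n\<in>UNIV. q $ n)"
      by (simp add: sum_distrib_left mult.commute)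
    also have "\<dots> \<le> (A_max + mu_max) * (N * norm q)"
      unfolding N_def using A_max_pos mu_max_nonneg by (intro mult_left_mono sum_le_card_norm) auto
    finally have "\<bar>\<Sum>n\<in>UNIV. q $ n * (a n - r n)\<bar> \<le> N * (A_max + mu_max) * norm q"
      by (simp add: mult_ac)
    moreover have "0 \<le> drift_const" by (simp add: drift_const_def)
    ultimately show ?thesis unfolding \<Delta>_def by linarith
  qed
  have "\<Delta>\<^sup>2 \<le> (2 * (N * (A_max + mu_max)) * norm q + drift_const)\<^sup>2"
    using abs by (metis abs_le_square_iff abs_ge_zero abs_of_nonneg order_trans)
  also have "\<dots> \<le> 2 * (2 * (N * (A_max + mu_max)) * norm q)\<^sup>2 + 2 * drift_const\<^sup>2"
    using sum_squares_bound[of "2 * (N * (A_max + mu_max)) * norm q" drift_const]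
    by (simp only: power2_sum)
  also have "\<dots> = 8 * (N * (A_max + mu_max))\<^sup>2 * (norm q)\<^sup>2 + 2 * drift_const\<^sup>2"
    by (simp add: power_mult_distrib)
  finally have \<Delta>2: "\<Delta>\<^sup>2 \<le> 8 * (N * (A_max + mu_max))\<^sup>2 * (norm q)\<^sup>2 + 2 * drift_const\<^sup>2" .
  have "norm (step q w) ^ 4 = ((norm (step q w))\<^sup>2)\<^sup>2" by simp
  also have "\<dots> \<le> ((norm q)\<^sup>2 + \<Delta>)\<^sup>2" by (intro power_mono sq) auto
  also have "\<dots> = norm q ^ 4 + 2 * (norm q)\<^sup>2 * \<Delta> + \<Delta>\<^sup>2" by (simp add: power2_sum)
  finally show ?thesis using \<Delta>2 unfolding \<Delta>_def N_def a_def r_def by linarith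
qed

end

text \<open>Serves both starts, the predicted arrivals of the windows and the zero vector.
  Measurability in the history at time 0 keeps the start independent of all later inputs.\<close>

locale started_queue =
  predictive_backpressure M A S lam p_ch PP mu f A_max P_max mu_max f_max V \<eta> rl D
  for M :: "'w measure"
    and A :: "nat \<Rightarrow> 'w \<Rightarrow> real ^ 'n" and S :: "nat \<Rightarrow> 'w \<Rightarrow> 's::finite"
    and lam p_ch PP mu f A_max P_max mu_max f_max V \<eta> rl D +
  fixes z :: "'w \<Rightarrow> real ^ 'n" and B :: real
  assumes z_measurable: "z \<in> borel_measurable (history D lookahead 0)"
    and z_nonneg: "\<And>\<omega>. \<omega> \<in> space M \<Longrightarrow> 0 \<le> z \<omega>"
    and z_le: "\<And>\<omega> n. \<omega> \<in> space M \<Longrightarrow> z \<omega> $ n \<le> B"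
begin

abbreviation queue where "queue \<equiv> chain step z (input D lookahead)"

lemma queue_nonneg: "\<omega> \<in> space M \<Longrightarrow> 0 \<le> queue t \<omega>"
  by (rule chain_nonneg) (auto intro: z_nonneg)

lemma queue_history: "queue t \<in> borel_measurable (history D lookahead t)"
  by (rule chain_measurable_history[OF step_measurable z_measurable])

lemma random_queue [measurable]: "queue t \<in> borel_measurable M"
  by (rule random_chain[OF windows step_measurable z_measurable])

lemma integrable_queue:
  assumes [measurable]: "g \<in> borel_measurable borel" and h: "continuous_on UNIV h"
    and g: "\<And>q. 0 \<le> q \<Longrightarrow> \<bar>g q\<bar> \<le> h q"
  shows "integrable M (\<lambda>\<omega>. g (queue t \<omega>) :: real)"
proof -
  define K :: "(real ^ 'n) set" where "K = cbox 0 (\<chi> n. B + real t * A_max)"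
  have "bounded (h ` K)"
    by (intro compact_imp_bounded compact_continuous_image continuous_on_subset[OF h]) (auto simp: K_def)
  then obtain C where C: "\<And>q. q \<in> K \<Longrightarrow> \<bar>h q\<bar> \<le> C"
    unfolding bounded_iff by auto
  have "\<bar>g (queue t \<omega>)\<bar> \<le> C" if \<omega>: "\<omega> \<in> space M" for \<omega>
  proof -
    have "queue t \<omega> \<in> K"
      using queue_nonneg[OF \<omega>] chain_le[OF \<omega>, of z B lookahead t] z_nonneg z_le \<omega>
      by (auto simp: K_def mem_box_cart less_eq_vec_def)
    then show ?thesis using g[OF queue_nonneg[OF \<omega>]] C by (meson abs_ge_self order_trans)
  qed
  then show ?thesis by (intro integrable_const_bound[where B=C]) (auto intro!: AE_I2)
qed

lemma integrable_continuous_queue: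
  "continuous_on UNIV g \<Longrightarrow> integrable M (\<lambda>\<omega>. g (queue t \<omega>) :: real)"
  by (rule integrable_queue[where h = "\<lambda>q. \<bar>g q\<bar>"])
    (auto intro!: borel_measurable_continuous_onI continuous_intros)

lemma
  assumes [measurable]: "g \<in> borel_measurable borel" "k \<in> arrival_channel \<rightarrow>\<^sub>M borel"
    and int: "integrable M (\<lambda>\<omega>. g (queue t \<omega>) :: real)" "integrable M (\<lambda>\<omega>. k (input D lookahead t \<omega>) :: real)"
  shows integrable_queue_input: "integrable M (\<lambda>\<omega>. g (queue t \<omega>) * k (input D lookahead t \<omega>))"
    and expectation_queue_input: "expectation (\<lambda>\<omega>. g (queue t \<omega>) * k (input D lookahead t \<omega>))
      = expectation (\<lambda>\<omega>. g (queue t \<omega>)) * expectation (\<lambda>\<omega>. k (input D lookahead t \<omega>))"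
proof -
  have "indep_var borel (\<lambda>\<omega>. g (queue t \<omega>)) borel (\<lambda>\<omega>. k (input D lookahead t \<omega>))"
  proof (rule indep_var_generated[OF indep_slot_components[OF windows]])
    show "past lookahead t \<inter> range (\<lambda>j. (t + lookahead j, j)) = {}" by (auto simp: past_def)
    show "(\<lambda>\<omega>. g (queue t \<omega>)) \<in> borel_measurable (history D lookahead t)"
      by (rule measurable_compose[OF queue_history]) fact
    show "(\<lambda>\<omega>. k (input D lookahead t \<omega>)) \<in>
        borel_measurable (generated (\<lambda>_. arrival_channel) (slot_component D) (range (\<lambda>j. (t + lookahead j, j))))"
      by (rule measurable_compose[OF measurable_input_generated]) auto
  qed
  from indep_var_integrable[OF this int] indep_var_lebesgue_integral[OF this int]
  show "integrable M (\<lambda>\<omega>. g (queue t \<omega>) * k (input D lookahead t \<omega>))"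
    "expectation (\<lambda>\<omega>. g (queue t \<omega>) * k (input D lookahead t \<omega>))
      = expectation (\<lambda>\<omega>. g (queue t \<omega>)) * expectation (\<lambda>\<omega>. k (input D lookahead t \<omega>))" .
qed

lemma
  shows integrable_admitted: "integrable M (\<lambda>\<omega>. fst (input D lookahead t \<omega>) $ n)"
    and expectation_admitted: "expectation (\<lambda>\<omega>. fst (input D lookahead t \<omega>) $ n) = lam $ n"
proof -
  show "integrable M (\<lambda>\<omega>. fst (input D lookahead t \<omega>) $ n)"
    by (rule integrable_const_bound[where B=A_max]) (use input_bounds in \<open>auto intro!: AE_I2\<close>)
  show "expectation (\<lambda>\<omega>. fst (input D lookahead t \<omega>) $ n) = lam $ n"
    by (simp add: input_lookahead arrivals_mean)
qed

lemma expectation_channel: "expectation (\<lambda>\<omega>. indicat_real {s} (snd (input D lookahead t \<omega>))) = p_ch s"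
proof -
  have "expectation (\<lambda>\<omega>. indicat_real {s} (snd (input D lookahead t \<omega>)))
      = expectation (indicat_real {\<omega>\<in>space M. S t \<omega> = s})"
    by (intro Bochner_Integration.integral_cong) (auto simp: input_lookahead indicator_def)
  then show ?thesis by (simp add: channel_prob)
qed

text \<open>The rate depends jointly on queue and channel state. Decomposing over the finitely many
  states with indicators turns each summand into a function of the queue times a function of the
  input, and these factors are independent.\<close>

lemma
  shows integrable_drift: "integrable M (\<lambda>\<omega>. (norm (queue t \<omega>))\<^sup>2 *
        (\<Sum>n\<in>UNIV. queue t \<omega> $ n * (admitted t \<omega> $ n - rate n (snd (input D lookahead t \<omega>)) (queue t \<omega>))))" (is ?int)
    and expectation_drift: "expectation (\<lambda>\<omega>. (norm (queue t \<omega>))\<^sup>2 *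
        (\<Sum>n\<in>UNIV. queue t \<omega> $ n * (admitted t \<omega> $ n - rate n (snd (input D lookahead t \<omega>)) (queue t \<omega>))))
      = expectation (\<lambda>\<omega>. (norm (queue t \<omega>))\<^sup>2 *
        (\<Sum>n\<in>UNIV. queue t \<omega> $ n * (lam $ n - (\<Sum>s\<in>UNIV. p_ch s * rate n s (queue t \<omega>)))))" (is ?eq)
    and integrable_mean_drift: "integrable M (\<lambda>\<omega>. (norm (queue t \<omega>))\<^sup>2 *
        (\<Sum>n\<in>UNIV. queue t \<omega> $ n * (lam $ n - (\<Sum>s\<in>UNIV. p_ch s * rate n s (queue t \<omega>)))))" (is ?mean)
proof -
  let ?W = "input D lookahead t"
  define g where "g n q = (norm q)\<^sup>2 * q $ n" for n and q :: "real ^ 'n"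
  define k where "k n s q = g n q * rate n s q" for n s q
  have contg: "continuous_on UNIV (g n)" for n
    unfolding g_def by (intro continuous_intros)
  then have [measurable]: "g n \<in> borel_measurable borel" for n
    by (rule borel_measurable_continuous_onI)
  have [measurable]: "k n s \<in> borel_measurable borel" for n s
    unfolding k_def by measurable
  have ig: "integrable M (\<lambda>\<omega>. g n (queue t \<omega>))" for n
    by (rule integrable_continuous_queue[OF contg])
  have ik: "integrable M (\<lambda>\<omega>. k n s (queue t \<omega>))" for n s
  proof (rule integrable_queue[where h = "\<lambda>q. \<bar>g n q\<bar> * mu_max"])
    show "continuous_on UNIV (\<lambda>q. \<bar>g n q\<bar> * mu_max)" by (intro continuous_intros contg)
    show "\<bar>k n s q\<bar> \<le> \<bar>g n q\<bar> * mu_max" for q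
      using rate_nonneg[of n s q] rate_le[of n s q] by (simp add: k_def abs_mult mult_left_mono)
  qed measurable
  have ic: "integrable M (\<lambda>\<omega>. indicator {s} (snd (?W \<omega>)) :: real)" for s
    by (rule integrable_const_bound[where B=1]) (auto simp: indicator_def intro!: AE_I2)
  have iga: "integrable M (\<lambda>\<omega>. g n (queue t \<omega>) * fst (?W \<omega>) $ n)" for n
    by (rule integrable_queue_input[where k = "\<lambda>w. fst w $ n"]) (auto intro: ig integrable_admitted)
  have ega: "expectation (\<lambda>\<omega>. g n (queue t \<omega>) * fst (?W \<omega>) $ n) = expectation (\<lambda>\<omega>. g n (queue t \<omega>)) * lam $ n" for n
    by (subst expectation_queue_input[where k = "\<lambda>w. fst w $ n"]) (auto intro: ig integrable_admitted simp: expectation_admitted)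
  have ikc: "integrable M (\<lambda>\<omega>. k n s (queue t \<omega>) * indicator {s} (snd (?W \<omega>)))" for n s
    by (rule integrable_queue_input[where k = "\<lambda>w. indicator {s} (snd w)"]) (auto intro: ik ic)
  have ekc: "expectation (\<lambda>\<omega>. k n s (queue t \<omega>) * indicator {s} (snd (?W \<omega>))) = expectation (\<lambda>\<omega>. k n s (queue t \<omega>)) * p_ch s" for n s
    by (subst expectation_queue_input[where k = "\<lambda>w. indicator {s} (snd w)"]) (auto intro: ik ic simp: expectation_channel)
  have L: "(norm (queue t \<omega>))\<^sup>2 * (\<Sum>n\<in>UNIV. queue t \<omega> $ n * (admitted t \<omega> $ n - rate n (snd (?W \<omega>)) (queue t \<omega>)))
      = (\<Sum>n\<in>UNIV. g n (queue t \<omega>) * fst (?W \<omega>) $ n - (\<Sum>s\<in>UNIV. k n s (queue t \<omega>) * indicator {s} (snd (?W \<omega>))))" for \<omega>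
    by (simp add: sum_distrib_left g_def k_def algebra_simps indicator_def sum.delta')
  have R: "(norm (queue t \<omega>))\<^sup>2 * (\<Sum>n\<in>UNIV. queue t \<omega> $ n * (lam $ n - (\<Sum>s\<in>UNIV. p_ch s * rate n s (queue t \<omega>))))
      = (\<Sum>n\<in>UNIV. g n (queue t \<omega>) * lam $ n - (\<Sum>s\<in>UNIV. k n s (queue t \<omega>) * p_ch s))" for \<omega>
    by (simp add: sum_distrib_left g_def k_def algebra_simps)
  show ?int unfolding L
    by (intro Bochner_Integration.integrable_sum Bochner_Integration.integrable_diff iga ikc)
  show ?mean unfolding R
    by (intro Bochner_Integration.integrable_sum Bochner_Integration.integrable_diff integrable_mult_left ig ik)
  have "expectation (\<lambda>\<omega>. \<Sum>n\<in>UNIV. g n (queue t \<omega>) * fst (?W \<omega>) $ n - (\<Sum>s\<in>UNIV. k n s (queue t \<omega>) * indicator {s} (snd (?W \<omega>))))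
      = (\<Sum>n\<in>UNIV. expectation (\<lambda>\<omega>. g n (queue t \<omega>)) * lam $ n - (\<Sum>s\<in>UNIV. expectation (\<lambda>\<omega>. k n s (queue t \<omega>)) * p_ch s))"
    by (simp only: Bochner_Integration.integral_sum Bochner_Integration.integral_diff
        Bochner_Integration.integrable_sum Bochner_Integration.integrable_diff iga ikc ega ekc)
  moreover have "expectation (\<lambda>\<omega>. \<Sum>n\<in>UNIV. g n (queue t \<omega>) * lam $ n - (\<Sum>s\<in>UNIV. k n s (queue t \<omega>) * p_ch s))
      = (\<Sum>n\<in>UNIV. expectation (\<lambda>\<omega>. g n (queue t \<omega>)) * lam $ n - (\<Sum>s\<in>UNIV. expectation (\<lambda>\<omega>. k n s (queue t \<omega>)) * p_ch s))"
    by (simp add: ig ik)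
  ultimately show ?eq unfolding L R by simp
qed

text \<open>Multiplied by the squared norm, the linear negative drift becomes cubic. It dominates
  every quadratic term, including one extra copy of the second moment, which then appears with a
  negative sign.\<close>

lemma second_moment_drift:
  "\<exists>C. \<forall>t. expectation (\<lambda>\<omega>. norm (queue (Suc t) \<omega>) ^ 4)
      \<le> expectation (\<lambda>\<omega>. norm (queue t \<omega>) ^ 4) - expectation (\<lambda>\<omega>. (norm (queue t \<omega>))\<^sup>2) + C"
proof -
  obtain f_min where f_min: "\<And>s P. P \<in> PP s \<Longrightarrow> f_min \<le> f s P"
    using cost_bounded_below by blast
  define c2 where "c2 = 8 * (real CARD('n) * (A_max + mu_max))\<^sup>2"
  \<comment> \<open>Collects the quadratic coefficients: four times the cost gap of the drift, the
    terms of \<open>norm_step_pow4\<close>, and \<open>1\<close> for the copy to be kept. The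
    absolute value provides the nonnegativity that \<open>cubic_dominates\<close> asks for.\<close>
  define k where "k = \<bar>4 * (V * (f_max - f_min)) + 2 * drift_const + c2 + 1\<bar>"
  define C where "C = k * (k / (4 * \<eta>))\<^sup>2 + 2 * drift_const\<^sup>2"
  have "expectation (\<lambda>\<omega>. norm (queue (Suc t) \<omega>) ^ 4)
      \<le> expectation (\<lambda>\<omega>. norm (queue t \<omega>) ^ 4) - expectation (\<lambda>\<omega>. (norm (queue t \<omega>))\<^sup>2) + C" for t
  proof -
    let ?W = "input D lookahead t" and ?X = "queue t"
    define d where "d \<omega> = (norm (?X \<omega>))\<^sup>2 * (\<Sum>n\<in>UNIV. ?X \<omega> $ n * (admitted t \<omega> $ n - rate n (snd (?W \<omega>)) (?X \<omega>)))" for \<omega>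
    define e where "e \<omega> = (norm (?X \<omega>))\<^sup>2 * (\<Sum>n\<in>UNIV. ?X \<omega> $ n * (lam $ n - (\<Sum>s\<in>UNIV. p_ch s * rate n s (?X \<omega>))))" for \<omega>
    have i4: "integrable M (\<lambda>\<omega>. norm (queue t \<omega>) ^ 4)" for t
      by (rule integrable_continuous_queue) (intro continuous_intros)
    have i3: "integrable M (\<lambda>\<omega>. norm (queue t \<omega>) ^ 3)" for t
      by (rule integrable_continuous_queue) (intro continuous_intros)
    have i2: "integrable M (\<lambda>\<omega>. (norm (queue t \<omega>))\<^sup>2)" for t
      by (rule integrable_continuous_queue) (intro continuous_intros)
    have id: "integrable M d" unfolding d_def by (rule integrable_drift)
    have ed: "expectation d = expectation e" unfolding d_def e_def by (rule expectation_drift)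
    have e_le: "e \<omega> \<le> (norm (?X \<omega>))\<^sup>2 * (V * (f_max - f_min)) - \<eta> * norm (?X \<omega>) ^ 3" if \<omega>: "\<omega> \<in> space M" for \<omega>
    proof -
      have "(\<Sum>n\<in>UNIV. ?X \<omega> $ n * (lam $ n - (\<Sum>s\<in>UNIV. p_ch s * rate n s (?X \<omega>))))
          \<le> V * (f_max - f_min) - \<eta> * (\<Sum>n\<in>UNIV. ?X \<omega> $ n)"
        by (rule drift_le[OF f_min queue_nonneg[OF \<omega>]])
      also have "\<dots> \<le> V * (f_max - f_min) - \<eta> * norm (?X \<omega>)"
        using norm_le_sum_nonneg[OF queue_nonneg[OF \<omega>]] slack(1) by simp
      finally have "e \<omega> \<le> (norm (?X \<omega>))\<^sup>2 * (V * (f_max - f_min) - \<eta> * norm (?X \<omega>))"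
        unfolding e_def by (rule mult_left_mono) simp
      then show ?thesis by (simp add: right_diff_distrib power2_eq_square power3_eq_cube mult_ac)
    qed
    have "expectation d \<le> expectation (\<lambda>\<omega>. (norm (?X \<omega>))\<^sup>2 * (V * (f_max - f_min)) - \<eta> * norm (?X \<omega>) ^ 3)"
      unfolding ed
    proof (rule integral_mono[OF _ _ e_le])
      show "integrable M e" unfolding e_def by (rule integrable_mean_drift)
    qed (auto intro!: i2 i3)
    then have ed_le: "expectation d \<le> expectation (\<lambda>\<omega>. (norm (?X \<omega>))\<^sup>2) * (V * (f_max - f_min)) - \<eta> * expectation (\<lambda>\<omega>. norm (?X \<omega>) ^ 3)"
      using i2[of t] i3[of t] by simp
    have "expectation (\<lambda>\<omega>. norm (queue (Suc t) \<omega>) ^ 4)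
        \<le> expectation (\<lambda>\<omega>. norm (?X \<omega>) ^ 4 + 4 * d \<omega> + (2 * drift_const + c2) * (norm (?X \<omega>))\<^sup>2 + 2 * drift_const\<^sup>2)"
    proof (intro integral_mono i4 Bochner_Integration.integrable_add integrable_mult_right id i2)
      fix \<omega> assume \<omega>: "\<omega> \<in> space M"
      show "norm (queue (Suc t) \<omega>) ^ 4 \<le> norm (?X \<omega>) ^ 4 + 4 * d \<omega> + (2 * drift_const + c2) * (norm (?X \<omega>))\<^sup>2 + 2 * drift_const\<^sup>2"
        using norm_step_pow4[OF queue_nonneg[OF \<omega>, of t] input_bounds[OF \<omega>, of lookahead t]]
        unfolding d_def c2_def chain.simps by (simp add: algebra_simps)
    qed simp
    also have "\<dots> = expectation (\<lambda>\<omega>. norm (?X \<omega>) ^ 4) + 4 * expectation d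
        + (2 * drift_const + c2) * expectation (\<lambda>\<omega>. (norm (?X \<omega>))\<^sup>2) + 2 * drift_const\<^sup>2"
      using i4[of t] i2[of t] id by (simp add: prob_space)
    also have "\<dots> \<le> expectation (\<lambda>\<omega>. norm (?X \<omega>) ^ 4) - expectation (\<lambda>\<omega>. (norm (?X \<omega>))\<^sup>2) + 2 * drift_const\<^sup>2
        + expectation (\<lambda>\<omega>. k * (norm (?X \<omega>))\<^sup>2 - 4 * \<eta> * norm (?X \<omega>) ^ 3)"
    proof -
      have "(4 * (V * (f_max - f_min)) + 2 * drift_const + c2 + 1) * expectation (\<lambda>\<omega>. (norm (?X \<omega>))\<^sup>2)
          \<le> k * expectation (\<lambda>\<omega>. (norm (?X \<omega>))\<^sup>2)"
        unfolding k_def by (intro mult_right_mono abs_ge_self) simp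
      moreover have "expectation (\<lambda>\<omega>. k * (norm (?X \<omega>))\<^sup>2 - 4 * \<eta> * norm (?X \<omega>) ^ 3)
          = k * expectation (\<lambda>\<omega>. (norm (?X \<omega>))\<^sup>2) - 4 * \<eta> * expectation (\<lambda>\<omega>. norm (?X \<omega>) ^ 3)"
        using i3[of t] i2[of t] by simp
      ultimately show ?thesis using ed_le by (simp add: algebra_simps)
    qed
    also have "expectation (\<lambda>\<omega>. k * (norm (?X \<omega>))\<^sup>2 - 4 * \<eta> * norm (?X \<omega>) ^ 3) \<le> expectation (\<lambda>_. k * (k / (4 * \<eta>))\<^sup>2)"
    proof (intro integral_mono)
      show "k * (norm (?X \<omega>))\<^sup>2 - 4 * \<eta> * norm (?X \<omega>) ^ 3 \<le> k * (k / (4 * \<eta>))\<^sup>2" for \<omega>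
        using cubic_dominates[of "4 * \<eta>" k "norm (?X \<omega>)"] slack(1)
        by (simp add: k_def power2_eq_square power3_eq_cube algebra_simps)
    qed (auto intro!: i2 i3)
    finally show ?thesis by (simp add: C_def prob_space)
  qed
  then show ?thesis by blast
qed

text \<open>The drift inequality telescopes, and the remaining fourth moment is nonnegative. The
  \<open>+ 1\<close> accommodates the initial moment.\<close>

lemma second_moment_avg_bounded:
  "\<exists>C\<ge>0. \<forall>t. (\<Sum>\<tau><t. expectation (\<lambda>\<omega>. (norm (queue \<tau> \<omega>))\<^sup>2)) \<le> C * (real t + 1)"
proof -
  obtain C where C: "\<And>t. expectation (\<lambda>\<omega>. norm (queue (Suc t) \<omega>) ^ 4)
      \<le> expectation (\<lambda>\<omega>. norm (queue t \<omega>) ^ 4) - expectation (\<lambda>\<omega>. (norm (queue t \<omega>))\<^sup>2) + C"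
    using second_moment_drift by blast
  define E0 where "E0 = expectation (\<lambda>\<omega>. norm (queue 0 \<omega>) ^ 4)"
  have "(\<Sum>\<tau><t. expectation (\<lambda>\<omega>. (norm (queue \<tau> \<omega>))\<^sup>2)) + expectation (\<lambda>\<omega>. norm (queue t \<omega>) ^ 4) \<le> E0 + C * real t" for t
  proof (induction t)
    case (Suc t)
    then show ?case using C[of t] by (simp add: algebra_simps del: chain.simps)
  qed (simp add: E0_def)
  moreover have "0 \<le> expectation (\<lambda>\<omega>. norm (queue t \<omega>) ^ 4)" for t by simp
  ultimately have *: "(\<Sum>\<tau><t. expectation (\<lambda>\<omega>. (norm (queue \<tau> \<omega>))\<^sup>2)) \<le> E0 + C * real t" for t
    by (meson add_increasing2 order_trans le_add_same_cancel1)
  have "E0 + C * real t \<le> (\<bar>E0\<bar> + \<bar>C\<bar>) * (real t + 1)" for t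
  proof -
    have "C * real t \<le> \<bar>C\<bar> * real t" "0 \<le> \<bar>E0\<bar> * real t" by (auto intro: mult_right_mono)
    moreover have "(\<bar>E0\<bar> + \<bar>C\<bar>) * (real t + 1) = \<bar>E0\<bar> * real t + \<bar>C\<bar> * real t + \<bar>E0\<bar> + \<bar>C\<bar>"
      by (simp add: algebra_simps)
    ultimately show ?thesis by linarith
  qed
  with * show ?thesis by (intro exI[of _ "\<bar>E0\<bar> + \<bar>C\<bar>"]) (auto intro: order_trans)
qed

end

section \<open>Time averages\<close>

context predictive_backpressure
begin

definition start :: "'w \<Rightarrow> real ^ 'n" where
  "start \<omega> = (\<chi> n. \<Sum>d<D n. A d \<omega> $ n)"

text \<open>An initially predicted arrival of user \<open>n\<close> has slot \<open>d < D n\<close>,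
  which is within the horizon of its component at time 0; this gives measurability in the
  history.\<close>

lemma started_queue_start:
  "started_queue M A S lam p_ch PP mu f A_max P_max mu_max f_max V \<eta> rl D start (\<Sum>n\<in>UNIV. real (D n) * A_max)"
proof
  let ?H = "history D lookahead 0"
  have "(\<lambda>\<omega>. A d \<omega> $ n) \<in> borel_measurable ?H" if "d < D n" for d n
  proof -
    have "slot_component D (d, Some (D n)) \<in> ?H \<rightarrow>\<^sub>M arrival_channel"
      using that by (intro measurable_generated) (auto simp: past_def lookahead_def)
    then have "(\<lambda>\<omega>. fst (slot_component D (d, Some (D n)) \<omega>) $ n) \<in> borel_measurable ?H"
      by (intro borel_measurable_nth_comp measurable_fst')
    then show ?thesis by (simp add: slot_component_def component_simps)
  qed
  then show "start \<in> borel_measurable ?H"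
    unfolding start_def by (intro borel_measurable_vec_lambda borel_measurable_sum) auto
  show "0 \<le> start \<omega>" if "\<omega> \<in> space M" for \<omega>
    using arrivals_bounded[OF that] by (auto simp: start_def less_eq_vec_def intro!: sum_nonneg)
  show "start \<omega> $ n \<le> (\<Sum>n\<in>UNIV. real (D n) * A_max)" if "\<omega> \<in> space M" for \<omega> n
  proof -
    have "start \<omega> $ n \<le> real (card {..<D n}) * A_max"
      unfolding start_def vec_lambda_beta by (rule sum_bounded_above) (simp add: arrivals_bounded[OF that])
    also have "\<dots> \<le> (\<Sum>n\<in>UNIV. real (D n) * A_max)"
      using A_max_pos by (intro order_trans[OF _ member_le_sum[of n]]) auto
    finally show ?thesis .
  qed
qed

sublocale predicted: started_queue M A S lam p_ch PP mu f A_max P_max mu_max f_max V \<eta> rl D start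
    "\<Sum>n\<in>UNIV. real (D n) * A_max"
  by (rule started_queue_start)

sublocale empty: started_queue M A S lam p_ch PP mu f A_max P_max mu_max f_max V \<eta> rl D "\<lambda>_. 0" 0
  by unfold_locales auto

abbreviation bp :: "nat \<Rightarrow> 'w \<Rightarrow> real ^ 'n" where
  "bp \<equiv> bp_queue A S mu rl"

lemma random_bp [measurable]: "bp t \<in> borel_measurable M"
proof -
  have "chain step (\<lambda>_. 0) (input D (\<lambda>_. 0)) t \<in> borel_measurable M"
    by (rule random_chain[OF windows step_measurable]) simp
  then show ?thesis by (subst measurable_cong[OF bp_queue_eq_chain])
qed

lemma bp_nonneg: "\<omega> \<in> space M \<Longrightarrow> 0 \<le> bp t \<omega>"
  using chain_nonneg[where z = "\<lambda>_. 0"] by (simp add: bp_queue_eq_chain)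

text \<open>The predictive system started empty is Backpressure fed by the arrivals shifted into the
  prediction windows, which are distributed like the arrivals themselves.\<close>

lemma distr_bp: "distr M borel (bp t) = distr M borel (empty.queue t)"
  using distr_chain[OF windows step_measurable, of 0 "\<lambda>_. 0" t lookahead]
  by (subst distr_cong[OF refl refl bp_queue_eq_chain]) auto

lemma expectation_bp:
  assumes "g \<in> borel_measurable borel"
  shows "expectation (\<lambda>\<omega>. g (bp t \<omega>) :: real) = expectation (\<lambda>\<omega>. g (empty.queue t \<omega>))"
proof -
  have "expectation (\<lambda>\<omega>. g (bp t \<omega>)) = (\<integral>x. g x \<partial>distr M borel (bp t))"
    by (rule integral_distr[symmetric]) (use assms in auto)
  also have "\<dots> = expectation (\<lambda>\<omega>. g (empty.queue t \<omega>))"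
    unfolding distr_bp by (rule integral_distr) (use assms in auto)
  finally show ?thesis .
qed

lemma integrable_bp:
  assumes "continuous_on UNIV g"
  shows "integrable M (\<lambda>\<omega>. g (bp t \<omega>) :: real)"
proof -
  have [measurable]: "g \<in> borel_measurable borel"
    using assms by (rule borel_measurable_continuous_onI)
  have "integrable (distr M borel (empty.queue t)) g"
    by (subst integrable_distr_eq) (auto intro: empty.integrable_continuous_queue assms)
  then show ?thesis
    unfolding distr_bp[symmetric] by (subst (asm) integrable_distr_eq) auto
qed

text \<open>The steady state concerns predictive runs. A run from empty queues has the totals
  \<open>empty.queue\<close>, which agree in law with Backpressure at every slot, so the limit is
  inherited.\<close>

lemma long_run_bp:
  assumes \<nu>: "pbp_steady_state M A S mu rl D \<nu>" and h: "continuous_on UNIV h" "bounded (range h)"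
  shows "(\<lambda>t. 1 / real t * (\<Sum>\<tau><t. expectation (\<lambda>\<omega>. h (bp \<tau> \<omega>)))) \<longlonglongrightarrow> (\<integral>x. h x \<partial>\<nu>)"
proof -
  obtain Q where Q: "pbp_fifo_dynamics M A S mu rl D Q" "empty_start M D Q"
    using exists_empty_start by blast
  have "(\<lambda>t. 1 / real t * (\<Sum>\<tau><t. expectation (\<lambda>\<omega>. h (total_queue D (Q \<tau> \<omega>))))) \<longlonglongrightarrow> (\<integral>x. h x \<partial>\<nu>)"
    using \<nu> Q h unfolding pbp_steady_state_def long_run_distribution_def by blast
  moreover have "expectation (\<lambda>\<omega>. h (total_queue D (Q \<tau> \<omega>))) = expectation (\<lambda>\<omega>. h (bp \<tau> \<omega>))" for \<tau>
  proof -
    have "total_queue D (Q \<tau> \<omega>) = empty.queue \<tau> \<omega>" if \<omega>: "\<omega> \<in> space M" for \<omega>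
      using Q(2) \<omega> by (intro total_queue_eq_chain[OF Q(1) \<omega>])
        (auto simp: total_queue_def empty_start_def vec_eq_iff)
    then have "expectation (\<lambda>\<omega>. h (total_queue D (Q \<tau> \<omega>))) = expectation (\<lambda>\<omega>. h (empty.queue \<tau> \<omega>))"
      by (intro Bochner_Integration.integral_cong) auto
    then show ?thesis
      using expectation_bp[OF borel_measurable_continuous_onI[OF h(1)]] by simp
  qed
  ultimately show ?thesis by simp
qed

lemma total_queue_start:
  assumes "pbp_fifo_dynamics M A S mu rl D Q" "predicted_start M A D Q" "\<omega> \<in> space M"
  shows "total_queue D (Q t \<omega>) = predicted.queue t \<omega>"
proof (rule total_queue_eq_chain[OF assms(1,3)])
  show "total_queue D (Q 0 \<omega>) = start \<omega>"
    using assms(2,3) by (auto simp: total_queue_def predicted_start_def start_def sum_window vec_eq_iff)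
  show "0 \<le> start \<omega>" by (rule predicted.z_nonneg) fact
qed

lemma long_run_predicted:
  assumes \<nu>: "pbp_steady_state M A S mu rl D \<nu>" and h: "continuous_on UNIV h" "bounded (range h)"
    and Q: "pbp_fifo_dynamics M A S mu rl D Q" "predicted_start M A D Q"
  shows "(\<lambda>t. 1 / real t * (\<Sum>\<tau><t. expectation (\<lambda>\<omega>. h (predicted.queue \<tau> \<omega>)))) \<longlonglongrightarrow> (\<integral>x. h x \<partial>\<nu>)"
proof -
  have "(\<lambda>t. 1 / real t * (\<Sum>\<tau><t. expectation (\<lambda>\<omega>. h (total_queue D (Q \<tau> \<omega>))))) \<longlonglongrightarrow> (\<integral>x. h x \<partial>\<nu>)"
    using \<nu> Q h unfolding pbp_steady_state_def long_run_distribution_def by blast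
  moreover have "expectation (\<lambda>\<omega>. h (total_queue D (Q \<tau> \<omega>))) = expectation (\<lambda>\<omega>. h (predicted.queue \<tau> \<omega>))" for \<tau>
    by (intro Bochner_Integration.integral_cong) (auto simp: total_queue_start[OF Q])
  ultimately show ?thesis by simp
qed

text \<open>How far the total is from covering a window of maximal arrivals. The outer
  \<open>min\<close> is inactive for nonnegative \<open>x\<close>; it makes the function bounded
  everywhere and so a legitimate test function.\<close>

definition shortfall :: "'n \<Rightarrow> real ^ 'n \<Rightarrow> real" where
  "shortfall n x = min (max 0 (real (D n) * A_max - x $ n)) (real (D n) * A_max)"

lemma shortfall_bounds: "0 \<le> shortfall n x" "shortfall n x \<le> real (D n) * A_max"
  using A_max_pos by (auto simp: shortfall_def)

lemma continuous_shortfall: "continuous_on UNIV (shortfall n)"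
  unfolding shortfall_def by (intro continuous_intros)

lemma bounded_shortfall: "bounded (range (shortfall n))"
  using shortfall_bounds[of n] by (intro boundedI[of _ "real (D n) * A_max"]) auto

text \<open>The window holds at most \<open>D n * A_max\<close> arrivals, so the shortfall
  compensates whenever the total is less than the arrivals. The first bound serves users for whom no
  gain is claimed; the third permits integration of a possibly nonmeasurable backlog.\<close>

lemma backlog_le:
  assumes Q: "pbp_fifo_dynamics M A S mu rl D Q" "predicted_start M A D Q" and \<omega>: "\<omega> \<in> space M"
  shows "Q t \<omega> n (-1) \<le> predicted.queue t \<omega> $ n"
    and "Q t \<omega> n (-1) \<le> predicted.queue t \<omega> $ n - (\<Sum>d<D n. A (t + d) \<omega> $ n) + shortfall n (predicted.queue t \<omega>)"
    and "0 \<le> predicted.queue t \<omega> $ n - (\<Sum>d<D n. A (t + d) \<omega> $ n) + shortfall n (predicted.queue t \<omega>)"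
proof -
  let ?X = "predicted.queue t \<omega> $ n" and ?a = "\<Sum>d<D n. A (t + d) \<omega> $ n"
  have "Q t \<omega> n (-1) \<le> max 0 ((\<Sum>d\<in>window (D n). Q t \<omega> n d) - ?a)"
  proof (rule fifo_backlog_le[where a = "\<lambda>t. A t \<omega> $ n" and q = "\<lambda>t. Q t \<omega> n"
        and r = "\<lambda>t. mu n (S t \<omega>) (rl (S t \<omega>) (total_queue D (Q t \<omega>)))"])
    show "\<exists>m. (\<forall>d\<in>window (D n). 0 \<le> m d) \<and>
        fully_efficient (D n) (mu n (S t \<omega>) (rl (S t \<omega>) (total_queue D (Q t \<omega>)))) (Q t \<omega> n) m \<and>
        fifo (D n) (Q t \<omega> n) m \<and> queue_update (D n) (A (t + D n) \<omega> $ n) m (Q t \<omega> n) (Q (Suc t) \<omega> n)" for t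
      using Q(1) \<omega> unfolding pbp_fifo_dynamics_def by blast
  qed (use Q(2) \<omega> arrivals_bounded in \<open>auto simp: predicted_start_def\<close>)
  also have "(\<Sum>d\<in>window (D n). Q t \<omega> n d) = ?X"
    using total_queue_start[OF Q \<omega>, of t] by (simp add: total_queue_def vec_eq_iff)
  finally have Q1: "Q t \<omega> n (-1) \<le> max 0 (?X - ?a)" .
  have X: "0 \<le> ?X" using predicted.queue_nonneg[OF \<omega>] by (simp add: less_eq_vec_def)
  have a: "0 \<le> ?a" using arrivals_bounded[OF \<omega>] by (auto intro!: sum_nonneg)
  have "?a \<le> real (card {..<D n}) * A_max"
    by (rule sum_bounded_above) (simp add: arrivals_bounded[OF \<omega>])
  then have "?a \<le> real (D n) * A_max" by simp
  then show "0 \<le> ?X - ?a + shortfall n (predicted.queue t \<omega>)"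
    "Q t \<omega> n (-1) \<le> ?X - ?a + shortfall n (predicted.queue t \<omega>)"
    using Q1 X a by (auto simp: shortfall_def)
  show "Q t \<omega> n (-1) \<le> ?X" using Q1 X a by auto
qed

text \<open>\<open>I\<close> is free: users inside it are credited with the removed window, those
  outside get the trivial bound by the total. It will be chosen to produce the positive part in the
  final estimate.\<close>

lemma expectation_backlog_le:
  assumes Q: "pbp_fifo_dynamics M A S mu rl D Q" "predicted_start M A D Q"
  shows "expectation (\<lambda>\<omega>. \<Sum>n\<in>UNIV. Q t \<omega> n (-1))
    \<le> expectation (\<lambda>\<omega>. \<Sum>n\<in>UNIV. predicted.queue t \<omega> $ n)
      + (\<Sum>n\<in>I. expectation (\<lambda>\<omega>. shortfall n (predicted.queue t \<omega>)) - real (D n) * lam $ n)"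
proof -
  let ?X = "predicted.queue t"
  define b where "b n \<omega> = (if n \<in> I then shortfall n (?X \<omega>) - (\<Sum>d<D n. A (t + d) \<omega> $ n) else 0)" for n \<omega>
  have iX: "integrable M (\<lambda>\<omega>. ?X \<omega> $ n)" for n
    by (rule predicted.integrable_continuous_queue) (intro continuous_intros)
  have ish: "integrable M (\<lambda>\<omega>. shortfall n (?X \<omega>))" for n
    by (rule predicted.integrable_continuous_queue[OF continuous_shortfall])
  have iA: "integrable M (\<lambda>\<omega>. A u \<omega> $ n)" for u n
    by (rule integrable_const_bound[where B=A_max]) (use arrivals_bounded in \<open>auto intro!: AE_I2\<close>)
  have ib: "integrable M (b n)" for n
    unfolding b_def by (cases "n \<in> I") (auto intro!: ish iA)
  have eb: "expectation (b n) = (if n \<in> I then expectation (\<lambda>\<omega>. shortfall n (?X \<omega>)) - real (D n) * lam $ n else 0)" for n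
    unfolding b_def by (cases "n \<in> I") (simp_all add: ish iA arrivals_mean)
  have "expectation (\<lambda>\<omega>. \<Sum>n\<in>UNIV. Q t \<omega> n (-1)) \<le> expectation (\<lambda>\<omega>. \<Sum>n\<in>UNIV. ?X \<omega> $ n + b n \<omega>)"
  \<comment> \<open>\<open>Q\<close> carries no measurability assumption. The rule asks instead for
    an integrable and nonnegative upper bound.\<close>
  proof (rule integral_mono')
    show "integrable M (\<lambda>\<omega>. \<Sum>n\<in>UNIV. ?X \<omega> $ n + b n \<omega>)" by (auto intro!: iX ib)
    fix \<omega> assume \<omega>: "\<omega> \<in> space M"
    have X: "0 \<le> ?X \<omega> $ n" for n
      using predicted.queue_nonneg[OF \<omega>] by (simp add: less_eq_vec_def)
    have "Q t \<omega> n (-1) \<le> ?X \<omega> $ n + b n \<omega>" "0 \<le> ?X \<omega> $ n + b n \<omega>" for n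
      using backlog_le[OF Q \<omega>, of t n] X[of n] by (auto simp: b_def)
    then show "(\<Sum>n\<in>UNIV. Q t \<omega> n (-1)) \<le> (\<Sum>n\<in>UNIV. ?X \<omega> $ n + b n \<omega>)"
      "0 \<le> (\<Sum>n\<in>UNIV. ?X \<omega> $ n + b n \<omega>)"
      by (auto intro!: sum_mono sum_nonneg)
  qed
  also have "\<dots> = expectation (\<lambda>\<omega>. \<Sum>n\<in>UNIV. ?X \<omega> $ n) + (\<Sum>n\<in>UNIV. expectation (b n))"
    by (simp add: iX ib sum.distrib)
  also have "(\<Sum>n\<in>UNIV. expectation (b n))
      = (\<Sum>n\<in>I. expectation (\<lambda>\<omega>. shortfall n (?X \<omega>)) - real (D n) * lam $ n)"
    by (simp add: eb sum.If_cases)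
  finally show ?thesis .
qed

text \<open>Equality of the limit distributions passes to the means of the unbounded queue sizes: the
  second moments make the predictive queues uniformly integrable, and for Backpressure
  truncation bounds the mean from below.\<close>

lemma time_avg_predicted_le:
  assumes \<nu>: "pbp_steady_state M A S mu rl D \<nu>"
    and Q: "pbp_fifo_dynamics M A S mu rl D Q" "predicted_start M A D Q"
  shows "time_avg M (\<lambda>t \<omega>. \<Sum>n\<in>UNIV. predicted.queue t \<omega> $ n) \<le> time_avg M (\<lambda>t \<omega>. \<Sum>n\<in>UNIV. bp t \<omega> $ n)"
proof (rule ereal_le_epsilon2)
  fix e :: real assume e: "0 < e"
  define s where "s x = (\<Sum>n\<in>UNIV. x $ n)" for x :: "real ^ 'n"
  have s: "continuous_on UNIV s" unfolding s_def by (intro continuous_intros)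
  obtain C where C: "0 \<le> C" "\<And>t. (\<Sum>\<tau><t. expectation (\<lambda>\<omega>. (norm (predicted.queue \<tau> \<omega>))\<^sup>2)) \<le> C * (real t + 1)"
    using predicted.second_moment_avg_bounded by blast
  define N where "N = (real CARD('n))\<^sup>2"
  \<comment> \<open>Truncation at \<open>B\<close> costs at most \<open>N / B\<close> times the
    second moment, because \<open>s x \<le> (s x)\<^sup>2 / B\<close> above \<open>B\<close> and
    \<open>(s x)\<^sup>2 \<le> N * (norm x)\<^sup>2\<close>. With
    \<open>C * (t + 1) \<le> 2 * C * t\<close> the averaged cost is \<open>2 * N * C / B\<close>,
    which this choice keeps below \<open>e\<close>.\<close>
  define B where "B = 2 * N * C / e + 1"
  have B: "0 < B" using C(1) e by (simp add: B_def N_def add_nonneg_pos)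
  have BC: "2 * N * C / B \<le> e"
    using B e C(1) by (simp add: B_def N_def field_simps)
  define h where "h x = min B (max 0 (s x))" for x
  have h: "continuous_on UNIV h" "bounded (range h)"
    unfolding h_def using B by (auto intro!: continuous_intros s boundedI[of _ B])
  have ih: "integrable M (\<lambda>\<omega>. h (predicted.queue t \<omega>))" "integrable M (\<lambda>\<omega>. h (bp t \<omega>))" for t
    using h(1) by (auto intro: predicted.integrable_continuous_queue integrable_bp)
  have int_s: "integrable M (\<lambda>\<omega>. s (predicted.queue t \<omega>))" "integrable M (\<lambda>\<omega>. s (bp t \<omega>))" for t
    using s by (auto intro: predicted.integrable_continuous_queue integrable_bp)
  have i2: "integrable M (\<lambda>\<omega>. (norm (predicted.queue t \<omega>))\<^sup>2)" for t
    by (rule predicted.integrable_continuous_queue) (intro continuous_intros)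
  have up: "expectation (\<lambda>\<omega>. s (predicted.queue t \<omega>))
      \<le> expectation (\<lambda>\<omega>. h (predicted.queue t \<omega>)) + N / B * expectation (\<lambda>\<omega>. (norm (predicted.queue t \<omega>))\<^sup>2)" for t
  proof -
    have "expectation (\<lambda>\<omega>. s (predicted.queue t \<omega>))
        \<le> expectation (\<lambda>\<omega>. h (predicted.queue t \<omega>) + N / B * (norm (predicted.queue t \<omega>))\<^sup>2)"
    proof (rule integral_mono)
      fix \<omega> assume \<omega>: "\<omega> \<in> space M"
      let ?x = "predicted.queue t \<omega>"
      have s0: "0 \<le> s ?x"
        using predicted.queue_nonneg[OF \<omega>] by (auto simp: s_def less_eq_vec_def intro!: sum_nonneg)
      have "(s ?x)\<^sup>2 \<le> (real CARD('n) * norm ?x)\<^sup>2"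
        using s0 sum_le_card_norm[of ?x] by (intro power_mono) (simp_all add: s_def)
      then have s2: "(s ?x)\<^sup>2 \<le> N * (norm ?x)\<^sup>2" by (simp add: N_def power_mult_distrib)
      show "s ?x \<le> h ?x + N / B * (norm ?x)\<^sup>2"
      proof (cases "s ?x \<le> B")
        case True
        then show ?thesis using s0 B by (simp add: h_def N_def)
      next
        case False
        then have "B * s ?x \<le> (s ?x)\<^sup>2" using s0 by (simp add: power2_eq_square mult_right_mono)
        then have "s ?x \<le> N / B * (norm ?x)\<^sup>2" using s2 B by (simp add: field_simps)
        moreover have "0 \<le> h ?x" using B by (simp add: h_def)
        ultimately show ?thesis by simp
      qed
    qed (intro Bochner_Integration.integrable_add integrable_mult_right int_s ih i2)+
    also have "\<dots> = expectation (\<lambda>\<omega>. h (predicted.queue t \<omega>)) + N / B * expectation (\<lambda>\<omega>. (norm (predicted.queue t \<omega>))\<^sup>2)"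
      by (simp add: ih i2)
    finally show ?thesis .
  qed
  have lo: "expectation (\<lambda>\<omega>. h (bp t \<omega>)) \<le> expectation (\<lambda>\<omega>. s (bp t \<omega>))" for t
  proof (intro integral_mono ih int_s)
    fix \<omega> assume "\<omega> \<in> space M"
    from bp_nonneg[OF this, of t] have "0 \<le> s (bp t \<omega>)" by (auto simp: s_def less_eq_vec_def intro!: sum_nonneg)
    then show "h (bp t \<omega>) \<le> s (bp t \<omega>)" by (simp add: h_def)
  qed
  have avg: "1 / real t * (\<Sum>\<tau><t. expectation (\<lambda>\<omega>. s (predicted.queue \<tau> \<omega>)))
      \<le> 1 / real t * (\<Sum>\<tau><t. expectation (\<lambda>\<omega>. h (predicted.queue \<tau> \<omega>))) + e" if t: "0 < t" for t
  proof -
    have "(\<Sum>\<tau><t. expectation (\<lambda>\<omega>. s (predicted.queue \<tau> \<omega>)))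
        \<le> (\<Sum>\<tau><t. expectation (\<lambda>\<omega>. h (predicted.queue \<tau> \<omega>)) + N / B * expectation (\<lambda>\<omega>. (norm (predicted.queue \<tau> \<omega>))\<^sup>2))"
      by (intro sum_mono up)
    also have "\<dots> = (\<Sum>\<tau><t. expectation (\<lambda>\<omega>. h (predicted.queue \<tau> \<omega>)))
        + N / B * (\<Sum>\<tau><t. expectation (\<lambda>\<omega>. (norm (predicted.queue \<tau> \<omega>))\<^sup>2))"
      by (simp add: sum.distrib sum_distrib_left)
    also have "N / B * (\<Sum>\<tau><t. expectation (\<lambda>\<omega>. (norm (predicted.queue \<tau> \<omega>))\<^sup>2)) \<le> N / B * (C * (2 * real t))"
    proof (rule mult_left_mono)
      have "C * (real t + 1) \<le> C * (2 * real t)" using C(1) t by (intro mult_left_mono) auto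
      then show "(\<Sum>\<tau><t. expectation (\<lambda>\<omega>. (norm (predicted.queue \<tau> \<omega>))\<^sup>2)) \<le> C * (2 * real t)"
        using C(2)[of t] by linarith
    qed (use B in \<open>simp add: N_def\<close>)
    also have "N / B * (C * (2 * real t)) = 2 * N * C / B * real t" by simp
    also have "\<dots> \<le> e * real t" by (intro mult_right_mono BC) simp
    finally show ?thesis using t by (simp add: field_simps)
  qed
  have "time_avg M (\<lambda>t \<omega>. s (predicted.queue t \<omega>))
      \<le> limsup (\<lambda>t. ereal (1 / real t * (\<Sum>\<tau><t. expectation (\<lambda>\<omega>. h (predicted.queue \<tau> \<omega>))) + e))"
    unfolding time_avg_def
    by (intro Limsup_mono eventually_mono[OF eventually_gt_at_top[of 0]]) (use avg in auto)
  also have "\<dots> = ereal ((\<integral>x. h x \<partial>\<nu>) + e)"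
    using long_run_predicted[OF \<nu> h Q] by (intro lim_imp_Limsup) (auto intro!: tendsto_intros)
  also have "\<dots> = limsup (\<lambda>t. ereal (1 / real t * (\<Sum>\<tau><t. expectation (\<lambda>\<omega>. h (bp \<tau> \<omega>))))) + ereal e"
  proof -
    have "limsup (\<lambda>t. ereal (1 / real t * (\<Sum>\<tau><t. expectation (\<lambda>\<omega>. h (bp \<tau> \<omega>))))) = ereal (\<integral>x. h x \<partial>\<nu>)"
      using long_run_bp[OF \<nu> h] by (intro lim_imp_Limsup) (auto intro!: tendsto_intros)
    then show ?thesis by simp
  qed
  also have "\<dots> \<le> time_avg M (\<lambda>t \<omega>. s (bp t \<omega>)) + ereal e"
    unfolding time_avg_def
    by (intro add_right_mono Limsup_mono always_eventually allI) (auto intro!: divide_right_mono sum_mono lo)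
  finally show "time_avg M (\<lambda>t \<omega>. \<Sum>n\<in>UNIV. predicted.queue t \<omega> $ n) \<le> time_avg M (\<lambda>t \<omega>. \<Sum>n\<in>UNIV. bp t \<omega> $ n) + ereal e"
    by (simp add: s_def)
qed

text \<open>Under Backpressure the shortfall vanishes off the deviation event, since the queue then
  exceeds \<open>D n * A_max\<close>, and is at most that number on it. Being bounded and continuous
  it has converging averages, so the frequency bound passes to the limit law.\<close>

lemma long_run_shortfall_le:
  assumes \<nu>: "pbp_steady_state M A S mu rl D \<nu>"
    and conc: "time_avg_prob M (\<lambda>\<tau> \<omega>. \<exists>n. \<bar>bp \<tau> \<omega> $ n - \<gamma> $ n\<bar> > b) \<le> ereal p"
    and D: "0 < D n \<Longrightarrow> real (D n) * A_max \<le> \<gamma> $ n - b"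
  shows "(\<integral>x. shortfall n x \<partial>\<nu>) \<le> real (D n) * (A_max * p)"
proof (cases "D n = 0")
  case True
  then show ?thesis by (simp add: shortfall_def)
next
  case False
  define c where "c = real (D n) * A_max"
  have c: "0 < c" using False A_max_pos by (simp add: c_def)
  define E where "E \<tau> = {\<omega>\<in>space M. \<exists>n. \<bar>bp \<tau> \<omega> $ n - \<gamma> $ n\<bar> > b}" for \<tau>
  have [measurable]: "E \<tau> \<in> events" for \<tau>
    unfolding E_def by measurable
  have le: "expectation (\<lambda>\<omega>. shortfall n (bp \<tau> \<omega>)) \<le> c * prob (E \<tau>)" for \<tau>
  proof -
    have "expectation (\<lambda>\<omega>. shortfall n (bp \<tau> \<omega>)) \<le> expectation (\<lambda>\<omega>. c * indicator (E \<tau>) \<omega>)"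
    proof (rule integral_mono)
      fix \<omega> assume \<omega>: "\<omega> \<in> space M"
      show "shortfall n (bp \<tau> \<omega>) \<le> c * indicator (E \<tau>) \<omega>"
      proof (cases "\<omega> \<in> E \<tau>")
        case True
        then show ?thesis using shortfall_bounds by (simp add: c_def)
      next
        case nE: False
        then have "\<bar>bp \<tau> \<omega> $ n - \<gamma> $ n\<bar> \<le> b" using \<omega> by (auto simp: E_def not_less)
        then have "c \<le> bp \<tau> \<omega> $ n" using D False by (simp add: c_def)
        then show ?thesis using nE c by (simp add: shortfall_def c_def)
      qed
    next
      show "integrable M (\<lambda>\<omega>. c * indicator (E \<tau>) \<omega>)"
        by (intro integrable_mult_right integrable_real_indicator) (auto simp: emeasure_eq_measure)
    qed (intro integrable_bp continuous_shortfall)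
    then show ?thesis by simp
  qed
  have "(\<lambda>t. ereal (1 / real t * (\<Sum>\<tau><t. expectation (\<lambda>\<omega>. shortfall n (bp \<tau> \<omega>))) / c))
      \<longlonglongrightarrow> ereal ((\<integral>x. shortfall n x \<partial>\<nu>) / c)"
    unfolding lim_ereal using c
    by (intro tendsto_divide long_run_bp[OF \<nu> continuous_shortfall bounded_shortfall] tendsto_const) simp
  then have "ereal ((\<integral>x. shortfall n x \<partial>\<nu>) / c) = limsup (\<lambda>t. ereal (1 / real t * (\<Sum>\<tau><t. expectation (\<lambda>\<omega>. shortfall n (bp \<tau> \<omega>))) / c))"
    by (intro lim_imp_Limsup[symmetric]) auto
  also have "\<dots> \<le> time_avg_prob M (\<lambda>\<tau> \<omega>. \<exists>n. \<bar>bp \<tau> \<omega> $ n - \<gamma> $ n\<bar> > b)"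
    unfolding time_avg_prob_def E_def[symmetric]
  proof (intro Limsup_mono always_eventually allI)
    fix t
    have "(\<Sum>\<tau><t. expectation (\<lambda>\<omega>. shortfall n (bp \<tau> \<omega>))) / c \<le> (\<Sum>\<tau><t. prob (E \<tau>))"
      unfolding sum_divide_distrib using c le by (intro sum_mono) (simp add: field_simps)
    then have "1 / real t * ((\<Sum>\<tau><t. expectation (\<lambda>\<omega>. shortfall n (bp \<tau> \<omega>))) / c) \<le> 1 / real t * (\<Sum>\<tau><t. prob (E \<tau>))"
      by (rule mult_left_mono) simp
    then show "ereal (1 / real t * (\<Sum>\<tau><t. expectation (\<lambda>\<omega>. shortfall n (bp \<tau> \<omega>))) / c) \<le> ereal (1 / real t * (\<Sum>\<tau><t. prob (E \<tau>)))"
      by simp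
  qed
  also note conc
  finally show ?thesis using c by (simp add: c_def field_simps)
qed

lemma time_avg_backlog_le:
  assumes \<nu>: "pbp_steady_state M A S mu rl D \<nu>"
    and conc: "time_avg_prob M (\<lambda>\<tau> \<omega>. \<exists>n. \<bar>bp \<tau> \<omega> $ n - \<gamma> $ n\<bar> > b) \<le> ereal p"
    and D: "\<And>n. 0 < D n \<Longrightarrow> real (D n) * A_max \<le> \<gamma> $ n - b"
    and Q: "pbp_fifo_dynamics M A S mu rl D Q" "predicted_start M A D Q"
  shows "time_avg M (\<lambda>t \<omega>. \<Sum>n\<in>UNIV. Q t \<omega> n (-1))
    \<le> time_avg M (\<lambda>t \<omega>. \<Sum>n\<in>UNIV. bp t \<omega> $ n) - ereal (\<Sum>n\<in>UNIV. real (D n) * max 0 (lam $ n - A_max * p))"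
proof -
  \<comment> \<open>Users whose mean arrival rate beats the error; for all others the positive part
    in the claim is zero.\<close>
  define I where "I = {n. A_max * p < lam $ n}"
  define u where "u \<tau> = expectation (\<lambda>\<omega>. \<Sum>n\<in>UNIV. predicted.queue \<tau> \<omega> $ n)" for \<tau>
  define v where "v n \<tau> = expectation (\<lambda>\<omega>. shortfall n (predicted.queue \<tau> \<omega>))" for n \<tau>
  define w where "w t = (\<Sum>n\<in>I. 1 / real t * (\<Sum>\<tau><t. v n \<tau>) - real (D n) * lam $ n)" for t
  define w' where "w' = (\<Sum>n\<in>I. (\<integral>x. shortfall n x \<partial>\<nu>) - real (D n) * lam $ n)"
  have w: "(\<lambda>t. ereal (w t)) \<longlonglongrightarrow> ereal w'"
    unfolding w_def w'_def v_def lim_ereal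
    by (intro tendsto_intros long_run_predicted[OF \<nu> continuous_shortfall bounded_shortfall Q])
  have "time_avg M (\<lambda>t \<omega>. \<Sum>n\<in>UNIV. Q t \<omega> n (-1)) \<le> limsup (\<lambda>t. ereal (w t) + ereal (1 / real t * (\<Sum>\<tau><t. u \<tau>)))"
    unfolding time_avg_def
  proof (intro Limsup_mono eventually_mono[OF eventually_gt_at_top[of 0]])
    fix t :: nat assume t: "0 < t"
    have "(\<Sum>\<tau><t. expectation (\<lambda>\<omega>. \<Sum>n\<in>UNIV. Q \<tau> \<omega> n (-1)))
        \<le> (\<Sum>\<tau><t. u \<tau> + (\<Sum>n\<in>I. v n \<tau> - real (D n) * lam $ n))"
      unfolding u_def v_def by (intro sum_mono expectation_backlog_le[OF Q])
    also have "\<dots> = (\<Sum>\<tau><t. u \<tau>) + (\<Sum>n\<in>I. (\<Sum>\<tau><t. v n \<tau>) - real t * (real (D n) * lam $ n))"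
      unfolding sum.distrib by (subst sum.swap) (simp add: sum_subtractf)
    finally have "1 / real t * (\<Sum>\<tau><t. expectation (\<lambda>\<omega>. \<Sum>n\<in>UNIV. Q \<tau> \<omega> n (-1)))
        \<le> 1 / real t * ((\<Sum>\<tau><t. u \<tau>) + (\<Sum>n\<in>I. (\<Sum>\<tau><t. v n \<tau>) - real t * (real (D n) * lam $ n)))"
      by (intro mult_left_mono) auto
    also have "\<dots> = w t + 1 / real t * (\<Sum>\<tau><t. u \<tau>)"
      using t by (simp add: w_def add_divide_distrib sum_divide_distrib diff_divide_distrib)
    finally show "ereal (1 / real t * (\<Sum>\<tau><t. expectation (\<lambda>\<omega>. \<Sum>n\<in>UNIV. Q \<tau> \<omega> n (-1))))
        \<le> ereal (w t) + ereal (1 / real t * (\<Sum>\<tau><t. u \<tau>))"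
      by simp
  qed
  \<comment> \<open>The correction \<open>w\<close> converges to a finite limit, so the limit
    superior splits exactly.\<close>
  also have "\<dots> = ereal w' + limsup (\<lambda>t. ereal (1 / real t * (\<Sum>\<tau><t. u \<tau>)))"
    by (rule ereal_limsup_lim_add[OF w]) simp
  also have "\<dots> \<le> ereal w' + time_avg M (\<lambda>t \<omega>. \<Sum>n\<in>UNIV. bp t \<omega> $ n)"
    using time_avg_predicted_le[OF \<nu> Q] unfolding time_avg_def u_def by (rule add_left_mono)
  also have "\<dots> \<le> ereal (- (\<Sum>n\<in>UNIV. real (D n) * max 0 (lam $ n - A_max * p))) + time_avg M (\<lambda>t \<omega>. \<Sum>n\<in>UNIV. bp t \<omega> $ n)"
  proof (rule add_right_mono)
    have "w' \<le> (\<Sum>n\<in>I. - (real (D n) * (lam $ n - A_max * p)))"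
      unfolding w'_def using long_run_shortfall_le[OF \<nu> conc D] by (intro sum_mono) (auto simp: algebra_simps)
    also have "\<dots> = - (\<Sum>n\<in>UNIV. if n \<in> I then real (D n) * (lam $ n - A_max * p) else 0)"
      by (simp add: sum_negf sum.If_cases)
    also have "\<dots> = - (\<Sum>n\<in>UNIV. real (D n) * max 0 (lam $ n - A_max * p))"
      by (intro arg_cong[where f=uminus] sum.cong) (auto simp: I_def max_def)
    finally show "ereal w' \<le> ereal (- (\<Sum>n\<in>UNIV. real (D n) * max 0 (lam $ n - A_max * p)))" by simp
  qed
  finally show ?thesis by (simp add: minus_ereal_def add.commute)
qed

end

theorem theorem9:
  fixes M :: "'w measure"
    and A :: "nat \<Rightarrow> 'w \<Rightarrow> real ^ 'n" and S :: "nat \<Rightarrow> 'w \<Rightarrow> 's::finite"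
    and lam :: "real ^ 'n" and p_ch :: "'s \<Rightarrow> real"
    and PP :: "'s \<Rightarrow> (real ^ 'n) set"
    and mu :: "'n \<Rightarrow> 's \<Rightarrow> real ^ 'n \<Rightarrow> real" and f :: "'s \<Rightarrow> real ^ 'n \<Rightarrow> real"
    and A_max P_max mu_max f_max \<eta> L G K c :: real
    and rule :: "real \<Rightarrow> 's \<Rightarrow> real ^ 'n \<Rightarrow> real ^ 'n"
    and \<gamma>star :: "real \<Rightarrow> real ^ 'n"
    and D :: "real \<Rightarrow> 'n \<Rightarrow> nat"
  assumes system: "slotted_system M A S lam p_ch PP mu f A_max P_max mu_max f_max"
    and windows: "\<forall>\<^sub>F V in at_top. independent_across_windows M A (D V)"
    and rule: "\<forall>\<^sub>F V in at_top. backpressure_rule PP mu f V (rule V)"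
    and dual_optimal: "\<forall>\<^sub>F V in at_top. \<forall>\<gamma>.
          is_arg_max (dual_function lam p_ch PP mu f V) (\<lambda>\<gamma>. 0 \<le> \<gamma>) \<gamma> \<longleftrightarrow> \<gamma> = \<gamma>star V"
    and slack: "\<eta> > 0" "slack_condition lam p_ch PP mu \<eta>"
    and polyhedral: "L > 0"
          "\<forall>\<^sub>F V in at_top. \<forall>\<gamma>\<ge>0. dual_function lam p_ch PP mu f V (\<gamma>star V)
             \<ge> dual_function lam p_ch PP mu f V \<gamma> + L * norm (\<gamma>star V - \<gamma>)"
    and gamma_pos: "\<forall>\<^sub>F V in at_top. \<forall>n. \<gamma>star V $ n > 0"
    and gamma_Theta: "\<And>n. (\<lambda>V. \<gamma>star V $ n) \<in> \<Theta>(\<lambda>V. V)"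
    and concentration_consts: "G > 0" "K > 0" "c > 0"
    and concentration: "\<forall>\<^sub>F V in at_top. \<forall>m\<ge>0.
          time_avg_prob M (\<lambda>\<tau> \<omega>. \<exists>n. \<bar>bp_queue A S mu (rule V) \<tau> \<omega> $ n - \<gamma>star V $ n\<bar> > G + K * m)
            \<le> ereal (c * exp (- m))"
    and steady_state: "\<forall>\<^sub>F V in at_top. \<exists>\<nu>. pbp_steady_state M A S mu (rule V) (D V) \<nu>"
    and window_size: "\<forall>\<^sub>F V in at_top. \<forall>n.
          real (D V n) \<le> 1 / A_max * max 0 (\<gamma>star V $ n - G - K * (ln V)\<^sup>2 - mu_max)"
  shows "\<exists>\<epsilon> :: 'n \<Rightarrow> real \<Rightarrow> real.
           (\<forall>n. \<epsilon> n \<in> O(\<lambda>V. 1 / V powr ln V)) \<and>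
           (\<forall>\<^sub>F V in at_top. \<forall>Q.
              pbp_fifo_dynamics M A S mu (rule V) (D V) Q \<longrightarrow> predicted_start M A (D V) Q \<longrightarrow>
              time_avg M (\<lambda>t \<omega>. \<Sum>n\<in>UNIV. Q t \<omega> n (-1))
                \<le> time_avg M (\<lambda>t \<omega>. \<Sum>n\<in>UNIV. bp_queue A S mu (rule V) t \<omega> $ n)
                   - ereal (\<Sum>n\<in>UNIV. real (D V n) * max 0 (lam $ n - \<epsilon> n V)))"
\<comment> \<open>One error serves all users: \<open>A_max\<close> times the concentration bound at
  \<open>m = (ln V)\<^sup>2\<close>, for which \<open>exp (- m)\<close> is
  \<open>1 / V powr ln V\<close>.\<close>
proof (intro exI[of _ "\<lambda>_ V. A_max * (c * (1 / V powr ln V))"] conjI allI)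
  show "(\<lambda>V. A_max * (c * (1 / V powr ln V))) \<in> O(\<lambda>V. 1 / V powr ln V)"
    by (intro landau_o.big.cmult_in_iff' bigoI[of _ "\<bar>A_max * c\<bar>"]) (auto simp: abs_mult)
  interpret slotted_system M A S lam p_ch PP mu f A_max P_max mu_max f_max by (rule system)
  show "\<forall>\<^sub>F V in at_top. \<forall>Q.
      pbp_fifo_dynamics M A S mu (rule V) (D V) Q \<longrightarrow> predicted_start M A (D V) Q \<longrightarrow>
      time_avg M (\<lambda>t \<omega>. \<Sum>n\<in>UNIV. Q t \<omega> n (-1))
        \<le> time_avg M (\<lambda>t \<omega>. \<Sum>n\<in>UNIV. bp_queue A S mu (rule V) t \<omega> $ n)
           - ereal (\<Sum>n\<in>UNIV. real (D V n) * max 0 (lam $ n - A_max * (c * (1 / V powr ln V))))"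
    using windows rule concentration steady_state window_size eventually_gt_at_top[of 0]
  proof eventually_elim
    case (elim V)
    interpret predictive_backpressure M A S lam p_ch PP mu f A_max P_max mu_max f_max V \<eta> "rule V" "D V"
      by unfold_locales (use elim slack in auto)
    obtain \<nu> where \<nu>: "pbp_steady_state M A S mu (rule V) (D V) \<nu>" using elim by blast
    have "exp (- (ln V)\<^sup>2) = 1 / V powr ln V"
      using elim by (simp add: powr_def exp_minus power2_eq_square divide_inverse)
    then have conc: "time_avg_prob M (\<lambda>\<tau> \<omega>. \<exists>n. \<bar>bp \<tau> \<omega> $ n - \<gamma>star V $ n\<bar> > G + K * (ln V)\<^sup>2)
        \<le> ereal (c * (1 / V powr ln V))"
      using elim(3)[rule_format, of "(ln V)\<^sup>2"] by simp
    \<comment> \<open>A positive window forces the positive part in the window bound to be its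
      argument.\<close>
    have size: "real (D V n) * A_max \<le> \<gamma>star V $ n - (G + K * (ln V)\<^sup>2)" if "0 < D V n" for n
    proof -
      have "real (D V n) * A_max \<le> max 0 (\<gamma>star V $ n - G - K * (ln V)\<^sup>2 - mu_max)"
        using elim(5) A_max_pos by (simp add: field_simps)
      moreover have "0 < real (D V n) * A_max" using that A_max_pos by simp
      ultimately show ?thesis using mu_max_nonneg by linarith
    qed
    show ?case
      using time_avg_backlog_le[OF \<nu> conc size] by blast
  qed
qed

end
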